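(* Let $\vartheta$ be the coarsest topology on $\mathcal M(\mathcal I)$ such that (1) for all $a,b\in\mathcal I\cap\mathbb Q$ with $a<b$, the mapping $\mathcal M(\mathcal I)\to[0,\infty]:m\mapsto m((a,b))$ is lower semicontinuous; (2) for all $a,b\in\mathcal I\cap\mathbb Q$ with $a\le b$, the mapping $\mathcal M(\mathcal I)\to[0,\infty]:m\mapsto m([a,b])$ is upper semicontinuous. Then $(\mathcal M(\mathcal I),\vartheta)$ is a compact absolute retract.
   Context: $\mathcal I=(\alpha,\beta)\subset\mathbb R$ is an open interval, $-\infty\le\alpha<\beta\le\infty$, with Borel $\sigma$-field $\mathcal B(\mathcal I)$. $\mathcal M(\mathcal I)$ is the set of nonnegative, regular, not necessarily finite (nor locally finite) measures $m:\mathcal B(\mathcal I)\to[0,\infty]$, where regular means that for every $A\in\mathcal B(\mathcal I)$, $m(A)=\inf\{m(O):A\subset O,\ O\text{ open}\}=\sup\{m(K):K\subset A,\ K\text{ compact}\}$. A metric space $(E,d)$ is an absolute retract (AR) if, for any continuous map $f:E\to E'$ into a metric space $(E',d')$ such that $f$ is a homeomorphism between $E$ and $f(E)$ and $f(E)$ is closed in $E'$, there exists a continuous map $g:E'\to f(E)$ such that $g(x)=x$ for all $x\in f(E)$. This is a topological property; saying that the topological space $(\mathcal M(\mathcal I),\vartheta)$ is a compact absolute retract means that it is metrizable and compact and that it is an AR for a metric inducing $\vartheta$. *)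

theory Defs
  imports "HOL-Analysis.Analysis"
begin

text \<open>A measure on the Borel sigma-field of \<open>I\<close> is a \<^typ>\<open>real measure\<close> whose sets are those of
  \<open>restrict_space borel I\<close>; its underlying space is then \<open>I\<close> as well, and two such measures are
  equal iff they agree on all Borel subsets of \<open>I\<close>. No finiteness of any kind is required.
  Open sets are those relatively open in \<open>I\<close>, and infima and suprema are taken in
  \<^typ>\<open>ennreal\<close>.\<close>

definition regular_measure_on :: "real set \<Rightarrow> real measure \<Rightarrow> bool" where
  "regular_measure_on I m \<longleftrightarrow>
     (\<forall>A \<in> sets (restrict_space borel I).
        emeasure m A = (INF U \<in> {U. A \<subseteq> U \<and> openin (top_of_set I) U}. emeasure m U) \<and>
        emeasure m A = (SUP K \<in> {K. K \<subseteq> A \<and> compact K}. emeasure m K))"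

definition regular_measures :: "real set \<Rightarrow> real measure set" where
  "regular_measures I =
     {m. sets m = sets (restrict_space borel I) \<and> regular_measure_on I m}"

definition lower_semicontinuous_map ::
    "'a topology \<Rightarrow> ('a \<Rightarrow> 'b::linorder) \<Rightarrow> bool" where
  "lower_semicontinuous_map X f \<longleftrightarrow> (\<forall>t. openin X {x \<in> topspace X. t < f x})"

definition upper_semicontinuous_map ::
    "'a topology \<Rightarrow> ('a \<Rightarrow> 'b::linorder) \<Rightarrow> bool" where
  "upper_semicontinuous_map X f \<longleftrightarrow> (\<forall>t. openin X {x \<in> topspace X. f x < t})"

definition coarsest_topology_on ::
    "'a set \<Rightarrow> ('a topology \<Rightarrow> bool) \<Rightarrow> 'a topology \<Rightarrow> bool" where
  "coarsest_topology_on S P X \<longleftrightarrow>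
     topspace X = S \<and> P X \<and>
     (\<forall>Y. topspace Y = S \<and> P Y \<longrightarrow> (\<forall>U. openin X U \<longrightarrow> openin Y U))"

definition interval_semicontinuous :: "real set \<Rightarrow> real measure topology \<Rightarrow> bool" where
  "interval_semicontinuous I X \<longleftrightarrow>
     (\<forall>a \<in> I \<inter> \<rat>. \<forall>b \<in> I \<inter> \<rat>. a < b \<longrightarrow>
        lower_semicontinuous_map X (\<lambda>m. emeasure m {a<..<b})) \<and>
     (\<forall>a \<in> I \<inter> \<rat>. \<forall>b \<in> I \<inter> \<rat>. a \<le> b \<longrightarrow>
        upper_semicontinuous_map X (\<lambda>m. emeasure m {a..b}))"

text \<open>The ambient metric spaces range over all metric spaces whose points are taken from the type
  \<open>'b\<close>. Since HOL cannot quantify over types inside a formula, the type is a parameter; a theorem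
  in which \<open>'b\<close> is a type variable covers every type, hence all metric spaces.\<close>

definition absolute_retract :: "'b itself \<Rightarrow> 'a metric \<Rightarrow> bool" where
  "absolute_retract (_ :: 'b itself) E \<longleftrightarrow>
     (\<forall>(E' :: 'b metric) f.
        embedding_map (mtopology_of E) (mtopology_of E') f \<and>
        closedin (mtopology_of E') (f ` mspace E) \<longrightarrow>
        (f ` mspace E) retract_of_space (mtopology_of E'))"

text \<open>Being an absolute retract depends only on the topology, so it does not matter whether it is
  asked for one or for all metrics inducing a metrizable topology. Asking it for all of them keeps
  the choice of the metric from depending on the type parameter.\<close>

definition compact_absolute_retract :: "'b itself \<Rightarrow> 'a topology \<Rightarrow> bool" where
  "compact_absolute_retract (_ :: 'b itself) X \<longleftrightarrow>
     metrizable_space X \<and> compact_space X \<and>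
     (\<forall>E. mtopology_of E = X \<longrightarrow> absolute_retract TYPE('b) E)"

text \<open>The coarsest topology exists and is unique.\<close>

lemma coarsest_topology_on_unique:
  assumes "coarsest_topology_on S P X" "coarsest_topology_on S P Y"
  shows "X = Y"
  using assms unfolding coarsest_topology_on_def topology_eq by blast

lemma ex_coarsest_interval_semicontinuous:
  "\<exists>X. coarsest_topology_on S (interval_semicontinuous I) X"
proof -
  let ?B = "insert S
     ({{m \<in> S. t < emeasure m {a<..<b}} | a b t. a \<in> I \<inter> \<rat> \<and> b \<in> I \<inter> \<rat> \<and> a < b} \<union>
      {{m \<in> S. emeasure m {a..b} < t} | a b t. a \<in> I \<inter> \<rat> \<and> b \<in> I \<inter> \<rat> \<and> a \<le> b})"
  let ?X = "topology_generated_by ?B"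
  have top: "topspace ?X = S"
    unfolding topology_generated_by_topspace by auto
  have "interval_semicontinuous I ?X"
    unfolding interval_semicontinuous_def lower_semicontinuous_map_def
      upper_semicontinuous_map_def top
    by (intro conjI ballI impI allI topology_generated_by_Basis) blast+
  moreover have "openin Y U"
    if Y: "topspace Y = S" "interval_semicontinuous I Y" and U: "openin ?X U" for Y U
  proof -
    have B: "openin Y V" if "V \<in> ?B" for V
      using that Y openin_topspace[of Y]
      unfolding interval_semicontinuous_def lower_semicontinuous_map_def
        upper_semicontinuous_map_def by auto
    have "generate_topology_on ?B U"
      using U openin_topology_generated_by by blast
    then show ?thesis
      by (induction rule: generate_topology_on.induct) (use B in auto)
  qed
  ultimately show ?thesis
    unfolding coarsest_topology_on_def using top by blast
qed

lemma absolute_retract_cong_topology: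
  assumes "mtopology_of E1 = mtopology_of E2" "absolute_retract TYPE('b) E1"
  shows "absolute_retract TYPE('b) E2"
  using assms unfolding absolute_retract_def by (metis topspace_mtopology_of)

end

theory Submission
  imports Defs
begin

text \<open>
  The space of regular measures is metrizable and compact, and it satisfies Dugundji's extension
  theorem because its topology is generated by convex sets.

  \<^emph>\<open>Compactness.\<close> Finitely additive contents on the compact subsets of \<open>I\<close> form a compact subset of
  a product of copies of \<open>[0, \<infinity>]\<close>. The usual construction (supremum over compact subsets of open
  sets, then infimum over open supersets, then Caratheodory's theorem) turns a content into a regular
  measure. This map is onto, since a regular measure is recovered from its values on compact sets,
  and it is continuous, since \<open>t < m (a, b)\<close> and \<open>m [a, b] < t\<close> are witnessed by the value of the
  content on a single compact set: a subset of \<open>(a, b)\<close>, and a slightly larger closed interval,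
  respectively. Hence its image is compact (\<open>compact_space_interval_subbase\<close>).

  \<^emph>\<open>Metrizability.\<close> If \<open>m (a, b) \<le> m' [a, b]\<close> for all rational \<open>a < b\<close>, then \<open>m \<le> m'\<close> on open sets.
  So for distinct measures \<open>m\<close> and \<open>m'\<close>, up to exchanging them, \<open>m' [a, b] < t < m (a, b)\<close> for some
  \<open>a\<close>, \<open>b\<close>, \<open>t\<close>, and the corresponding subbasic sets are disjoint neighbourhoods. The space is thus
  Hausdorff, it has a countable subbase, and Urysohn's theorem applies.

  \<^emph>\<open>Retraction.\<close> Measures with infinite mass cannot be averaged continuously: \<open>c * \<infinity>\<close> jumps at
  \<open>c = 0\<close>. But finite measures are dense (\<open>finite_measures_dense\<close>), and countable convex
  combinations of a dense sequence of finite measures are all that is needed. Let \<open>f\<close> embed the space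
  as a closed subset \<open>A\<close> of a metric space, and let \<open>\<nu> i\<close> be such a dense sequence. For \<open>x\<close> off \<open>A\<close>,
  let \<open>F x\<close> be a convex combination of the \<open>\<nu> i\<close> in which only those \<open>i\<close> carry weight for which
  \<open>f (\<nu> i)\<close> is less than twice as far from \<open>x\<close> as \<open>A\<close> is; on \<open>A\<close>, let \<open>F\<close> be the inverse of \<open>f\<close>. Then
  \<open>F\<close> is continuous at the points of \<open>A\<close> because the subbasic sets are convex, and elsewhere because
  the masses are locally uniformly convergent series. The retraction is \<open>f \<circ> F\<close>.
\<close>

section \<open>Metrization of compact spaces\<close>

text \<open>The family \<open>F\<close> of subbasic sets is nonempty, so \<open>\<Inter>F\<close> is a genuine basic
  neighbourhood: no empty intersection equal to the whole type can occur.\<close>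

lemma generated_topology_local_base:
  assumes "openin (topology_generated_by S) U" "x \<in> U"
  obtains F where "finite F" "F \<noteq> {}" "F \<subseteq> S" "x \<in> \<Inter>F" "\<Inter>F \<subseteq> U"
proof -
  have "generate_topology_on S U"
    using assms(1) by (rule openin_topology_generated_by)
  then have "x \<in> U \<longrightarrow> (\<exists>F. finite F \<and> F \<noteq> {} \<and> F \<subseteq> S \<and> x \<in> \<Inter>F \<and> \<Inter>F \<subseteq> U)"
  proof (induction rule: generate_topology_on.induct)
    case (Int a b)
    show ?case
    proof
      assume "x \<in> a \<inter> b"
      with Int obtain F G where "finite F" "F \<noteq> {}" "F \<subseteq> S" "x \<in> \<Inter>F" "\<Inter>F \<subseteq> a"
        "finite G" "G \<noteq> {}" "G \<subseteq> S" "x \<in> \<Inter>G" "\<Inter>G \<subseteq> b" by auto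
      then show "\<exists>F. finite F \<and> F \<noteq> {} \<and> F \<subseteq> S \<and> x \<in> \<Inter>F \<and> \<Inter>F \<subseteq> a \<inter> b"
        by (intro exI[of _ "F \<union> G"]) auto
    qed
  next
    case (UN K)
    then show ?case by (meson Union_iff Union_upper subset_trans)
  next
    case (Basis s)
    then show ?case by (intro impI exI[of _ "{s}"]) auto
  qed auto
  with assms(2) that show ?thesis by blast
qed

lemma second_countable_topology_generated_by:
  assumes "countable S"
  shows "second_countable (topology_generated_by S)"
  unfolding second_countable_def
proof (intro exI conjI ballI allI impI)
  let ?B = "Inter ` {F. finite F \<and> F \<subseteq> S \<and> F \<noteq> {}}"
  have "countable {F. finite F \<and> F \<subseteq> S}"
    using countable_Collect_finite_subset[OF assms] .
  then have "countable {F. finite F \<and> F \<subseteq> S \<and> F \<noteq> {}}"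
    by (rule countable_subset[rotated]) blast
  then show "countable ?B" by (rule countable_image)
  show "openin (topology_generated_by S) V" if V: "V \<in> ?B" for V
  proof -
    obtain F where F: "F \<in> {F. finite F \<and> F \<subseteq> S \<and> F \<noteq> {}}" "V = \<Inter>F"
      using V by (elim imageE)
    then have "openin (topology_generated_by S) s" if "s \<in> F" for s
      using that by (intro topology_generated_by_Basis) auto
    then show ?thesis
      unfolding F(2) using F(1) by (intro openin_Inter) auto
  qed
  show "\<exists>V\<in>?B. x \<in> V \<and> V \<subseteq> U" if U: "openin (topology_generated_by S) U \<and> x \<in> U" for U x
  proof -
    obtain F where "finite F" "F \<noteq> {}" "F \<subseteq> S" "x \<in> \<Inter>F" "\<Inter>F \<subseteq> U"
      using U generated_topology_local_base[of S U x] by metis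
    then show ?thesis by (intro bexI[of _ "\<Inter>F"] conjI imageI) simp_all
  qed
qed

text \<open>Urysohn's metrization theorem for compact spaces. Urysohn functions for the countably many
  pairs \<open>(U, V)\<close> of basic sets with \<open>X closure_of U \<subseteq> V\<close> form an injective continuous map into a
  countable power of the reals, which is closed because \<open>X\<close> is compact.\<close>

theorem compact_Hausdorff_second_countable_imp_metrizable:
  assumes comp: "compact_space X" and haus: "Hausdorff_space X" and "second_countable X"
  shows "metrizable_space X"
proof -
  obtain B where B: "countable B" "\<And>V. V \<in> B \<Longrightarrow> openin X V"
      "\<And>U x. openin X U \<Longrightarrow> x \<in> U \<Longrightarrow> \<exists>V\<in>B. x \<in> V \<and> V \<subseteq> U"
    using \<open>second_countable X\<close> unfolding second_countable_def by (elim exE conjE) simp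
  have normal: "normal_space X"
    using comp haus compact_Hausdorff_or_regular_imp_normal_space by blast
  define P where "P = {(U, V) \<in> B \<times> B. X closure_of U \<subseteq> V}"
  have "\<forall>p\<in>P. \<exists>f. continuous_map X (top_of_set {0..1}) f \<and> f ` (X closure_of fst p) \<subseteq> {0} \<and>
          f ` (topspace X - snd p) \<subseteq> {1::real}" (is "\<forall>p\<in>P. \<exists>f. ?Q' p f")
  proof
    fix p assume "p \<in> P"
    have p: "snd p \<in> B" "X closure_of fst p \<subseteq> snd p"
      using \<open>p \<in> P\<close> unfolding P_def by auto
    have "closedin X (X closure_of fst p)" "closedin X (topspace X - snd p)"
      using B(2)[OF p(1)] by auto
    moreover have "disjnt (X closure_of fst p) (topspace X - snd p)"
      using p(2) unfolding disjnt_def by blast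
    ultimately
    show "\<exists>f. ?Q' p f"
      using normal unfolding normal_space_iff_Urysohn by meson
  qed
  then obtain f where "\<forall>p\<in>P. ?Q' p (f p)"
    by (rule bchoice[THEN exE])
  then have f: "\<And>p. p \<in> P \<Longrightarrow> continuous_map X (top_of_set {0..1}) (f p)"
      "\<And>p. p \<in> P \<Longrightarrow> f p ` (X closure_of fst p) \<subseteq> {0::real}"
      "\<And>p. p \<in> P \<Longrightarrow> f p ` (topspace X - snd p) \<subseteq> {1}"
    by auto
  define Y where "Y = product_topology (\<lambda>_::'a set \<times> 'a set. euclideanreal) P"
  define h where "h x = (\<lambda>p\<in>P. f p x)" for x
  have "countable P"
    by (rule countable_subset[of _ "B \<times> B"]) (use B(1) in \<open>auto simp: P_def\<close>)
  then have Y: "metrizable_space Y"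
    unfolding Y_def metrizable_space_product_topology
    by (auto intro!: disjI2 metrizable_space_euclidean countable_subset[of _ P])
  have cont: "continuous_map X Y h"
    unfolding Y_def h_def using f(1) by (auto simp: continuous_map_componentwise continuous_map_in_subtopology)
  have inj: "inj_on h (topspace X)"
  proof (rule inj_onI, rule ccontr)
    fix x y assume xy: "x \<in> topspace X" "y \<in> topspace X" "h x = h y" "x \<noteq> y"
    have "closedin X {y}"
      using haus xy(2) by (simp add: Hausdorff_imp_t1_space closedin_t1_singleton)
    then have "openin X (topspace X - {y})" by blast
    then obtain V where V: "V \<in> B" "x \<in> V" "V \<subseteq> topspace X - {y}"
      using B(3) xy by blast
    have "regular_space X"
      using comp haus compact_Hausdorff_imp_regular_space by blast
    then obtain U' where U': "openin X U'" "x \<in> U'" "X closure_of U' \<subseteq> V"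
    proof -
      have "neighbourhood_base_of (closedin X) X"
        using \<open>regular_space X\<close> by (simp add: neighbourhood_base_of_closedin)
      then obtain U' C where "openin X U'" "closedin X C" "x \<in> U'" "U' \<subseteq> C" "C \<subseteq> V"
        using V(2) B(2)[OF V(1)] unfolding neighbourhood_base_of by meson
      with that[of U'] closure_of_minimal[of U' C X] show ?thesis by auto
    qed
    obtain U where U: "U \<in> B" "x \<in> U" "U \<subseteq> U'" using B(3) U' by blast
    have p: "(U, V) \<in> P"
      using U V U' closure_of_mono[of U U' X] by (auto simp: P_def)
    have "x \<in> X closure_of U"
      using U B(2) closure_of_subset openin_subset by (metis in_mono)
    then have "f (U, V) x = 0" using f(2)[OF p] by auto
    moreover have "f (U, V) y = 1" using f(3)[OF p] V xy by auto
    moreover have "f (U, V) x = f (U, V) y" using fun_cong[OF xy(3), of "(U, V)"] p by (simp add: h_def)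
    ultimately show False by simp
  qed
  have "closed_map X Y h"
    using continuous_imp_closed_map comp metrizable_imp_Hausdorff_space[OF Y] cont by blast
  then have "embedding_map X Y h"
    using injective_closed_imp_embedding_map cont inj by blast
  then have "X homeomorphic_space (subtopology Y (h ` topspace X))"
    by (rule embedding_map_imp_homeomorphic_space)
  then show ?thesis
    using homeomorphic_metrizable_space metrizable_space_subtopology Y by blast
qed

section \<open>Measures generated by contents on compact sets\<close>

text \<open>A content on the compact subsets of \<open>I\<close>: monotone, subadditive and additive on disjoint
  sets. It is a function on all sets, whose values at other sets are irrelevant, so that the
  contents form a subset of the product of copies of \<^typ>\<open>ennreal\<close> indexed by all sets.\<close>

definition compact_content :: "'a::topological_space set \<Rightarrow> ('a set \<Rightarrow> ennreal) \<Rightarrow> bool" where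
  "compact_content I l \<longleftrightarrow> l {} = 0 \<and>
     (\<forall>K L. compact K \<and> compact L \<and> K \<subseteq> I \<and> L \<subseteq> I \<longrightarrow>
        (K \<subseteq> L \<longrightarrow> l K \<le> l L) \<and> l (K \<union> L) \<le> l K + l L \<and>
        (K \<inter> L = {} \<longrightarrow> l (K \<union> L) = l K + l L))"

text \<open>The value that a content assigns to an open set by approximation from inside.\<close>

definition inner_content :: "('a::topological_space set \<Rightarrow> ennreal) \<Rightarrow> 'a set \<Rightarrow> ennreal" where
  "inner_content l U = (SUP K\<in>{K. K \<subseteq> U \<and> compact K}. l K)"

text \<open>The outer measure obtained from the inner contents of the relatively open sets.\<close>

definition outer_content ::
    "'a::topological_space set \<Rightarrow> ('a set \<Rightarrow> ennreal) \<Rightarrow> 'a set \<Rightarrow> ennreal" where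
  "outer_content I l A = (INF U\<in>{U. A \<subseteq> U \<and> openin (top_of_set I) U}. inner_content l U)"

text \<open>The Borel measure generated by a content. It is built by \<^const>\<open>measure_of\<close>, which yields a
  zero measure on arguments for which \<^const>\<open>outer_content\<close> is not a measure on the Borel
  sets of \<open>I\<close>; for contents it is one, by Caratheodory's theorem.\<close>

definition content_measure ::
    "'a::topological_space set \<Rightarrow> ('a set \<Rightarrow> ennreal) \<Rightarrow> 'a measure" where
  "content_measure I l = measure_of I (sets (restrict_space borel I)) (outer_content I l)"

lemma inner_content_mono: "U \<subseteq> V \<Longrightarrow> inner_content l U \<le> inner_content l V"
  unfolding inner_content_def by (rule SUP_subset_mono) auto

lemma inner_content_upper: "K \<subseteq> U \<Longrightarrow> compact K \<Longrightarrow> l K \<le> inner_content l U"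
  unfolding inner_content_def by (rule SUP_upper) auto

lemma less_inner_content_iff: "t < inner_content l U \<longleftrightarrow> (\<exists>K\<subseteq>U. compact K \<and> t < l K)"
  unfolding inner_content_def less_SUP_iff by auto

lemma outer_content_lower:
  "A \<subseteq> U \<Longrightarrow> openin (top_of_set I) U \<Longrightarrow> outer_content I l A \<le> inner_content l U"
  unfolding outer_content_def by (rule INF_lower) auto

lemma outer_content_mono: "A \<subseteq> B \<Longrightarrow> outer_content I l A \<le> outer_content I l B"
  unfolding outer_content_def by (rule INF_superset_mono) auto

lemma outer_content_lessE:
  assumes "outer_content I l A < t"
  obtains U where "A \<subseteq> U" "openin (top_of_set I) U" "inner_content l U < t"
  using assms unfolding outer_content_def INF_less_iff by auto

lemma outer_content_open:
  assumes "openin (top_of_set I) U"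
  shows "outer_content I l U = inner_content l U"
proof (rule antisym)
  show "outer_content I l U \<le> inner_content l U"
    using assms by (intro outer_content_lower) auto
  show "inner_content l U \<le> outer_content I l U"
    unfolding outer_content_def by (rule INF_greatest) (auto intro: inner_content_mono)
qed

lemma compact_covered_by_two_open_split:
  fixes K :: "'a::euclidean_space set"
  assumes "compact K" "open U" "open V" "K \<subseteq> U \<union> V"
  obtains K1 K2 where "compact K1" "compact K2" "K1 \<subseteq> U" "K2 \<subseteq> V" "K = K1 \<union> K2"
proof -
  have "compact (K - U)" "closed (K - V)" "(K - U) \<inter> (K - V) = {}"
    using assms by (auto intro: compact_diff compact_imp_closed)
  then obtain P Q where "open P" "open Q" "K - U \<subseteq> P" "K - V \<subseteq> Q" "P \<inter> Q = {}"
    using separation_normal_compact[of "K - U" "K - V"] by metis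
  with assms show ?thesis
    by (intro that[of "K - P" "K - Q"]) (auto intro: compact_diff)
qed

lemma compact_content_measure:
  assumes sets: "sets m = sets (restrict_space borel I)"
  shows "compact_content (I::'a::t2_space set) (emeasure m)"
proof -
  have K: "K \<in> sets m" if "compact K" "K \<subseteq> I" for K
    unfolding sets sets_restrict_space
    using that borel_compact[OF that(1)] by (metis image_eqI inf.absorb2)
  show ?thesis
    unfolding compact_content_def
    by (auto intro: emeasure_mono emeasure_subadditive plus_emeasure[symmetric] K)
qed

context
  fixes I :: "'a::euclidean_space set" and l
  assumes I: "open I" and l: "compact_content I l"
begin

lemma inner_content_Un_le:
  assumes "open U" "open V" "U \<subseteq> I" "V \<subseteq> I"
  shows "inner_content l (U \<union> V) \<le> inner_content l U + inner_content l V"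
  unfolding inner_content_def[of l "U \<union> V"]
proof (rule SUP_least, clarify)
  fix K assume K: "K \<subseteq> U \<union> V" "compact K"
  then obtain K1 K2 where K12: "compact K1" "compact K2" "K1 \<subseteq> U" "K2 \<subseteq> V" "K = K1 \<union> K2"
    using compact_covered_by_two_open_split assms by metis
  then have "l K \<le> l K1 + l K2"
    using l assms unfolding compact_content_def by blast
  also have "\<dots> \<le> inner_content l U + inner_content l V"
    using K12 by (intro add_mono inner_content_upper)
  finally show "l K \<le> inner_content l U + inner_content l V" .
qed

lemma inner_content_empty: "inner_content l {} = 0"
  using l by (auto simp: inner_content_def compact_content_def)

lemma inner_content_UN_le:
  fixes U :: "nat \<Rightarrow> 'a set"
  assumes U: "\<And>n. open (U n)" "\<And>n. U n \<subseteq> I"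
  shows "inner_content l (\<Union>n. U n) \<le> (\<Sum>n. inner_content l (U n))"
  unfolding inner_content_def[of l "\<Union>n. U n"]
proof (rule SUP_least, clarify)
  fix K assume K: "K \<subseteq> (\<Union>n. U n)" "compact K"
  have fin: "inner_content l (\<Union>i<n. U i) \<le> (\<Sum>i<n. inner_content l (U i))" for n
  proof (induction n)
    case (Suc n)
    have "inner_content l (\<Union>i<Suc n. U i) \<le> inner_content l (\<Union>i<n. U i) + inner_content l (U n)"
      unfolding lessThan_Suc UN_insert using U
      by (subst Un_commute) (intro inner_content_Un_le, auto)
    also have "\<dots> \<le> (\<Sum>i<Suc n. inner_content l (U i))"
      using Suc by (auto intro: add_right_mono)
    finally show ?case .
  qed (simp add: inner_content_empty)
  obtain F where F: "finite F" "K \<subseteq> (\<Union>i\<in>F. U i)"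
    using K U by (metis UNIV_I compactE_image)
  obtain n where "F \<subseteq> {..<n}"
    using F(1) finite_nat_iff_bounded by blast
  then have "K \<subseteq> (\<Union>i<n. U i)"
    using F(2) by blast
  then have "l K \<le> inner_content l (\<Union>i<n. U i)"
    using K(2) by (rule inner_content_upper)
  also have "\<dots> \<le> (\<Sum>i<n. inner_content l (U i))" by (rule fin)
  also have "\<dots> \<le> (\<Sum>n. inner_content l (U n))" by (rule sum_le_suminf) auto
  finally show "l K \<le> (\<Sum>n. inner_content l (U n))" .
qed

lemma outer_measure_space_outer_content: "outer_measure_space (Pow I) (outer_content I l)"
  unfolding outer_measure_space_def
proof (intro conjI)
  show "positive (Pow I) (outer_content I l)"
    unfolding positive_def by (subst outer_content_open) (auto simp: inner_content_empty)
  show "increasing (Pow I) (outer_content I l)"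
    unfolding increasing_def by (auto intro: outer_content_mono)
  show "countably_subadditive (Pow I) (outer_content I l)"
  proof (simp add: countably_subadditive_def, safe)
    fix A :: "nat \<Rightarrow> _"
    show "outer_content I l (\<Union>i. A i) \<le> (\<Sum>n. outer_content I l (A n))"
    proof (rule ennreal_le_epsilon)
      fix e :: real assume e: "0 < e" "(\<Sum>n. outer_content I l (A n)) < top"
      then have "outer_content I l (A n) < outer_content I l (A n) + e * (1/2)^Suc n" for n
        by (auto simp add: less_top dest!: ennreal_suminf_lessD)
      then have "\<exists>U. A n \<subseteq> U \<and> openin (top_of_set I) U \<and>
          inner_content l U < outer_content I l (A n) + e * (1/2)^Suc n" for n
        by (metis outer_content_lessE)
      then obtain U where U: "\<And>n. A n \<subseteq> U n" "\<And>n. open (U n)" "\<And>n. U n \<subseteq> I"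
          "\<And>n. inner_content l (U n) < outer_content I l (A n) + e * (1/2)^Suc n"
        unfolding openin_open_eq[OF I] by metis
      have "outer_content I l (\<Union>i. A i) \<le> inner_content l (\<Union>i. U i)"
        using U by (intro outer_content_lower) (auto simp: openin_open_eq[OF I], blast+)
      also have "\<dots> \<le> (\<Sum>n. inner_content l (U n))"
        by (rule inner_content_UN_le) (use U in auto)
      also have "\<dots> \<le> (\<Sum>n. outer_content I l (A n) + e * (1/2)^Suc n)"
        using U by (intro suminf_le less_imp_le) auto
      also have "\<dots> = (\<Sum>n. outer_content I l (A n)) + (\<Sum>n. ennreal e * ennreal ((1/2) ^ Suc n))"
        using \<open>0 < e\<close> by (subst suminf_add[symmetric])
          (auto simp del: ennreal_suminf_cmult simp add: ennreal_mult[symmetric])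
      also have "\<dots> = (\<Sum>n. outer_content I l (A n)) + e"
        unfolding ennreal_suminf_cmult
        by (subst suminf_ennreal_eq[OF zero_le_power power_half_series]) auto
      finally show "outer_content I l (\<Union>i. A i) \<le> (\<Sum>n. outer_content I l (A n)) + e" .
    qed
  qed
qed

text \<open>Caratheodory's condition for an open set \<open>U\<close>, tested on an open set \<open>V\<close>. A compact
  \<open>K \<subseteq> V \<inter> U\<close> and a compact \<open>L \<subseteq> V - K\<close> are disjoint subsets of \<open>V\<close>, so their contents add up
  to at most the inner content of \<open>V\<close>, and \<open>V - U\<close> is contained in the open set \<open>V - K\<close>.\<close>

lemma inner_content_split_le:
  assumes "open V" "V \<subseteq> I" "open U" "U \<subseteq> I"
  shows "outer_content I l (V \<inter> U) + outer_content I l (V - U) \<le> inner_content l V"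
proof -
  have *: "l K + outer_content I l (V - U) \<le> inner_content l V"
    if K: "compact K" "K \<subseteq> V \<inter> U" for K
  proof -
    have op: "open (V - K)" using assms K by (simp add: compact_imp_closed open_Diff)
    have "l K + inner_content l (V - K) = (SUP L\<in>{L. L \<subseteq> V - K \<and> compact L}. l K + l L)"
      unfolding inner_content_def by (rule ennreal_SUP_add_right) auto
    also have "\<dots> \<le> inner_content l V"
    proof (rule SUP_least, clarify)
      fix L assume L: "L \<subseteq> V - K" "compact L"
      have "compact K" "K \<subseteq> I" "L \<subseteq> I" "K \<inter> L = {}" using K L assms by auto
      then have "l K + l L = l (K \<union> L)"
        using l L(2) unfolding compact_content_def by metis
      also have "\<dots> \<le> inner_content l V"
        using K L by (intro inner_content_upper) auto
      finally show "l K + l L \<le> inner_content l V" .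
    qed
    finally have "l K + inner_content l (V - K) \<le> inner_content l V" .
    moreover have "outer_content I l (V - U) \<le> inner_content l (V - K)"
      using op K assms by (intro outer_content_lower) (auto simp: openin_open_eq[OF I])
    ultimately show ?thesis by (meson add_left_mono order_trans)
  qed
  have "outer_content I l (V \<inter> U) + outer_content I l (V - U) =
      inner_content l (V \<inter> U) + outer_content I l (V - U)"
    using assms by (subst outer_content_open) (auto simp: openin_open_eq[OF I])
  also have "\<dots> = (SUP K\<in>{K. K \<subseteq> V \<inter> U \<and> compact K}. l K + outer_content I l (V - U))"
    unfolding inner_content_def by (rule ennreal_SUP_add_left[symmetric]) auto
  also have "\<dots> \<le> inner_content l V"
    by (rule SUP_least) (use * in auto)
  finally show ?thesis .
qed

lemma open_in_lambda_system:
  assumes U: "open U" "U \<subseteq> I"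
  shows "U \<in> lambda_system I (Pow I) (outer_content I l)"
  unfolding lambda_system_def
proof (intro CollectI conjI ballI PowI U antisym)
  fix A assume "A \<in> Pow I"
  then have A: "A \<subseteq> I" by simp
  have "outer_content I l (U \<inter> A) + outer_content I l ((I - U) \<inter> A) \<le> inner_content l V"
    if V: "A \<subseteq> V" "open V" "V \<subseteq> I" for V
  proof -
    have "outer_content I l (U \<inter> A) + outer_content I l ((I - U) \<inter> A)
        \<le> outer_content I l (V \<inter> U) + outer_content I l (V - U)"
      using V by (intro add_mono outer_content_mono) auto
    also have "\<dots> \<le> inner_content l V" using V U by (intro inner_content_split_le)
    finally show ?thesis .
  qed
  then show "outer_content I l (U \<inter> A) + outer_content I l ((I - U) \<inter> A) \<le> outer_content I l A"
    unfolding outer_content_def[of I l A] by (intro INF_greatest) (auto simp: openin_open_eq[OF I])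
  have "subadditive (Pow I) (outer_content I l)"
    using outer_measure_space_outer_content unfolding outer_measure_space_def
    by (intro ring_of_sets.countably_subadditive_subadditive [OF ring_of_sets_Pow]) auto
  then have "outer_content I l (U \<inter> A \<union> (I - U) \<inter> A)
      \<le> outer_content I l (U \<inter> A) + outer_content I l ((I - U) \<inter> A)"
    using A by (intro subadditiveD) auto
  moreover have "U \<inter> A \<union> (I - U) \<inter> A = A" using A by auto
  ultimately show "outer_content I l A \<le> outer_content I l (U \<inter> A) + outer_content I l ((I - U) \<inter> A)"
    by simp
qed

lemma sets_content_measure [simp]: "sets (content_measure I l) = sets (restrict_space borel I)"
  and emeasure_content_measure:
    "A \<in> sets (restrict_space borel I) \<Longrightarrow> emeasure (content_measure I l) A = outer_content I l A"
proof -
  let ?L = "lambda_system I (Pow I) (outer_content I l)"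
  have ms: "measure_space I ?L (outer_content I l)"
    using sigma_algebra.caratheodory_lemma[OF sigma_algebra_Pow outer_measure_space_outer_content] .
  then interpret L: sigma_algebra I ?L
    by (simp add: measure_space_def)
  have borel: "sets borel = sigma_sets UNIV {S::'a set. open S}"
    unfolding borel_def by (simp add: sets_measure_of)
  have "sets (restrict_space borel I) = sigma_sets I {U. open U \<and> U \<subseteq> I}" (is "?B = _")
  proof -
    have "(\<inter>) I ` {S. open S} = {U. open U \<and> U \<subseteq> I}"
      using I by (auto simp: image_iff)
    moreover have "sets (restrict_space borel I) = sigma_sets I ((\<inter>) I ` {S. open S})"
      unfolding sets_restrict_space borel
      using I by (intro sigma_sets_Int) auto
    ultimately show ?thesis by simp
  qed
  then have sub: "?B \<subseteq> ?L"
    using open_in_lambda_system by (auto intro!: L.sigma_sets_subset)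
  have sa: "sigma_algebra I ?B"
    using sets.sigma_algebra_axioms[of "restrict_space borel I"] by (simp add: space_restrict_space)
  have ms': "measure_space I ?B (outer_content I l)"
    by (rule measure_down[OF ms sa sub])
  show s: "sets (content_measure I l) = ?B"
    unfolding content_measure_def using sa by (rule sigma_algebra.sets_measure_of_eq)
  show "A \<in> ?B \<Longrightarrow> emeasure (content_measure I l) A = outer_content I l A"
    unfolding content_measure_def using ms' sa
    by (intro emeasure_measure_of_sigma) (auto simp: measure_space_def)
qed

end

section \<open>Regularity\<close>

lemma sets_restrict_borel_iff:
  "open (I::'a::topological_space set) \<Longrightarrow>
     A \<in> sets (restrict_space borel I) \<longleftrightarrow> A \<in> sets borel \<and> A \<subseteq> I"
  by (subst sets_restrict_space_iff) auto

text \<open>On a set of finite measure, regularity is inherited from finite Borel measures on the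
  whole space.\<close>

lemma finite_on_open_regular:
  fixes I :: "'a::euclidean_space set"
  assumes I: "open I" and sets: "sets m = sets (restrict_space borel I)"
    and U: "U \<in> sets m" "emeasure m U \<noteq> \<infinity>" and A: "A \<in> sets m" "A \<subseteq> U"
  shows "emeasure m A = (SUP K\<in>{K. K \<subseteq> A \<and> compact K}. emeasure m K)"
    and "emeasure m A = (INF V\<in>{V. A \<subseteq> V \<and> open V}. emeasure m (U \<inter> V))"
proof -
  note * = sets_restrict_borel_iff[OF I, folded sets]
  have sp: "space m = I"
    using sets_eq_imp_space_eq[OF sets] by (simp add: space_restrict_space)
  define N where "N = distr (restrict_space m U) borel (\<lambda>x. x)"
  have meas: "(\<lambda>x. x) \<in> restrict_space m U \<rightarrow>\<^sub>M borel"
  proof (rule measurableI)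
    fix B :: "'a set" assume "B \<in> sets borel"
    then have "U \<inter> B \<in> sets m" using U(1) * by auto
    then show "(\<lambda>x. x) -` B \<inter> space (restrict_space m U) \<in> sets (restrict_space m U)"
      using U(1) sets.sets_into_space[OF U(1)]
      by (subst sets_restrict_space_iff) (auto simp: space_restrict_space Int_absorb1 Int_commute)
  qed simp
  have N: "emeasure N B = emeasure m (U \<inter> B)" if "B \<in> sets borel" for B
  proof -
    have "U \<subseteq> space m" using U(1) by (rule sets.sets_into_space)
    then have "(\<lambda>x. x) -` B \<inter> space (restrict_space m U) = U \<inter> B"
      by (auto simp: space_restrict_space)
    then show ?thesis
      unfolding N_def using that U(1) meas
      by (subst emeasure_distr) (auto simp: emeasure_restrict_space)
  qed
  have fin: "emeasure N (space N) \<noteq> \<infinity>" and sN: "sets N = sets borel"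
    using U(2) N[of UNIV] by (auto simp: N_def)
  have Ab: "A \<in> sets borel" and UA: "U \<inter> A = A" using A * by auto
  have "emeasure m A = emeasure N A" using N[OF Ab] UA by simp
  also have "\<dots> = (SUP K\<in>{K. K \<subseteq> A \<and> compact K}. emeasure N K)"
    by (rule inner_regular[OF sN fin Ab])
  also have "\<dots> = (SUP K\<in>{K. K \<subseteq> A \<and> compact K}. emeasure m K)"
    using A(2) by (intro SUP_cong) (auto simp: N borel_compact Int_absorb1)
  finally show "emeasure m A = (SUP K\<in>{K. K \<subseteq> A \<and> compact K}. emeasure m K)" .
  have "emeasure m A = emeasure N A" using N[OF Ab] UA by simp
  also have "\<dots> = (INF V\<in>{V. A \<subseteq> V \<and> open V}. emeasure N V)"
    by (rule outer_regular[OF sN fin Ab])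
  also have "\<dots> = (INF V\<in>{V. A \<subseteq> V \<and> open V}. emeasure m (U \<inter> V))"
    by (intro INF_cong) (auto simp: N)
  finally show "emeasure m A = (INF V\<in>{V. A \<subseteq> V \<and> open V}. emeasure m (U \<inter> V))" .
qed

text \<open>Without any finiteness assumption: if \<open>A\<close> contains a point of infinite mass, then this
  point is a compact subset of full mass. Otherwise outer regularity gives each point of \<open>A\<close> an
  open neighbourhood of finite measure, and countably many of these cover \<open>A\<close>.\<close>

lemma outer_regular_imp_inner_regular:
  fixes I :: "'a::euclidean_space set"
  assumes I: "open I" and sets: "sets m = sets (restrict_space borel I)"
    and outer: "\<And>A. A \<in> sets m \<Longrightarrow>
      emeasure m A = (INF U\<in>{U. A \<subseteq> U \<and> openin (top_of_set I) U}. emeasure m U)"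
    and A: "A \<in> sets m"
  shows "emeasure m A = (SUP K\<in>{K. K \<subseteq> A \<and> compact K}. emeasure m K)"
proof (cases "\<exists>x\<in>A. emeasure m {x} = \<infinity>")
  case True
  then obtain x where x: "x \<in> A" "emeasure m {x} = \<infinity>" by blast
  then have "emeasure m {x} \<le> (SUP K\<in>{K. K \<subseteq> A \<and> compact K}. emeasure m K)"
    by (intro SUP_upper) auto
  moreover have "emeasure m {x} \<le> emeasure m A"
    using x A by (intro emeasure_mono) auto
  ultimately show ?thesis
    using x(2) unfolding infinity_ennreal_def by (metis top.extremum_unique)
next
  case False
  note * = sets_restrict_borel_iff[OF I, folded sets]
  define \<F> where "\<F> = {U. open U \<and> U \<subseteq> I \<and> emeasure m U \<noteq> \<infinity>}"
  have cover: "A \<subseteq> \<Union>\<F>"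
  proof
    fix x assume x: "x \<in> A"
    with A * have "x \<in> I" by auto
    then have "emeasure m {x} = (INF U\<in>{U. {x} \<subseteq> U \<and> openin (top_of_set I) U}. emeasure m U)"
      using * by (intro outer) auto
    moreover have "emeasure m {x} < \<infinity>" using False x by (auto simp: less_top)
    ultimately obtain U where "{x} \<subseteq> U" "openin (top_of_set I) U" "emeasure m U < \<infinity>"
      by (auto simp: INF_less_iff)
    then show "x \<in> \<Union>\<F>"
      using I by (auto simp: \<F>_def openin_open_eq intro!: exI[of _ U])
  qed
  obtain \<G> where \<G>: "\<G> \<subseteq> \<F>" "countable \<G>" "\<Union>\<G> = \<Union>\<F>"
    using Lindelof[of \<F>] by (auto simp: \<F>_def)
  show ?thesis
  proof (cases "\<G> = {}")
    case True
    with \<G> cover have "A = {}" by auto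
    then show ?thesis by (auto intro!: SUP_eq_const[symmetric])
  next
    case False
    define U where "U = from_nat_into \<G>"
    have U: "U n \<in> \<F>" for n
      using from_nat_into[OF False, of n] \<G> by (auto simp: U_def)
    have range: "range U = \<G>"
      unfolding U_def using range_from_nat_into[OF False \<G>(2)] .
    define W where "W n = (\<Union>i<n. U i)" for n
    have Um: "U n \<in> sets m" for n using U * by (auto simp: \<F>_def)
    have Wm: "W n \<in> sets m" for n using Um by (auto simp: W_def)
    have Wfin: "emeasure m (W n) \<noteq> \<infinity>" for n
    proof -
      have "emeasure m (W n) \<le> (\<Sum>i<n. emeasure m (U i))"
        unfolding W_def using Um by (intro emeasure_subadditive_finite) auto
      also have "\<dots> < \<infinity>" using U by (auto simp: \<F>_def less_top)
      finally show ?thesis by simp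
    qed
    have "x \<in> (\<Union>n. A \<inter> W n)" if "x \<in> A" for x
    proof -
      have "x \<in> \<Union>(range U)" using that cover \<G>(3) range by auto
      then obtain n where "x \<in> U n" by blast
      then have "x \<in> W (Suc n)" by (auto simp: W_def)
      with that show ?thesis by blast
    qed
    then have "A = (\<Union>n. A \<inter> W n)" by auto
    then have "emeasure m A = emeasure m (\<Union>n. A \<inter> W n)" by simp
    also have "\<dots> = (SUP n. emeasure m (A \<inter> W n))"
      using A Wm by (intro SUP_emeasure_incseq[symmetric])
        (auto simp: incseq_def W_def dest: order_less_le_trans)
    also have "\<dots> \<le> (SUP K\<in>{K. K \<subseteq> A \<and> compact K}. emeasure m K)"
    proof (rule SUP_least)
      fix n
      have "emeasure m (A \<inter> W n) = (SUP K\<in>{K. K \<subseteq> A \<inter> W n \<and> compact K}. emeasure m K)"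
        using A Wm Wfin by (intro finite_on_open_regular(1)[OF I sets, of "W n"]) auto
      also have "\<dots> \<le> (SUP K\<in>{K. K \<subseteq> A \<and> compact K}. emeasure m K)"
        by (rule SUP_subset_mono) auto
      finally show "emeasure m (A \<inter> W n) \<le> (SUP K\<in>{K. K \<subseteq> A \<and> compact K}. emeasure m K)" .
    qed
    finally have "emeasure m A \<le> (SUP K\<in>{K. K \<subseteq> A \<and> compact K}. emeasure m K)" .
    moreover have "(SUP K\<in>{K. K \<subseteq> A \<and> compact K}. emeasure m K) \<le> emeasure m A"
      using A by (auto intro!: SUP_least emeasure_mono)
    ultimately show ?thesis by (rule antisym)
  qed
qed

lemma regular_measuresI:
  assumes I: "open I" and sets: "sets m = sets (restrict_space borel I)"
    and outer: "\<And>A. A \<in> sets m \<Longrightarrow>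
      emeasure m A = (INF U\<in>{U. A \<subseteq> U \<and> openin (top_of_set I) U}. emeasure m U)"
  shows "m \<in> regular_measures I"
  unfolding regular_measures_def regular_measure_on_def mem_Collect_eq
proof (intro conjI ballI)
  fix A assume "A \<in> sets (restrict_space borel I)"
  then have A: "A \<in> sets m" by (simp only: sets)
  show "emeasure m A = (INF U\<in>{U. A \<subseteq> U \<and> openin (top_of_set I) U}. emeasure m U)"
    using outer[OF A] .
  show "emeasure m A = (SUP K\<in>{K. K \<subseteq> A \<and> compact K}. emeasure m K)"
    using outer_regular_imp_inner_regular[OF I sets outer A] .
qed (rule sets)

lemma finite_imp_regular_measures:
  assumes I: "open I" and sets: "sets m = sets (restrict_space borel I)"
    and fin: "emeasure m I \<noteq> \<infinity>"
  shows "m \<in> regular_measures I"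
proof (rule regular_measuresI[OF I sets])
  note * = sets_restrict_borel_iff[OF I, folded sets]
  fix A assume A: "A \<in> sets m"
  have "emeasure m A = (INF V\<in>{V. A \<subseteq> V \<and> open V}. emeasure m (I \<inter> V))"
    using A * I fin by (intro finite_on_open_regular(2)[OF I sets]) auto
  also have "\<dots> = (INF U\<in>{U. A \<subseteq> U \<and> openin (top_of_set I) U}. emeasure m U)"
  proof (rule INF_eq)
    show "\<exists>V\<in>{U. A \<subseteq> U \<and> openin (top_of_set I) U}. emeasure m V \<le> emeasure m (I \<inter> W)"
      if "W \<in> {V. A \<subseteq> V \<and> open V}" for W
      using that A * I by (intro bexI[of _ "I \<inter> W"]) (auto simp: openin_open_eq)
    show "\<exists>V\<in>{V. A \<subseteq> V \<and> open V}. emeasure m (I \<inter> V) \<le> emeasure m W"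
      if "W \<in> {U. A \<subseteq> U \<and> openin (top_of_set I) U}" for W
      using that I by (intro bexI[of _ W]) (auto simp: openin_open_eq Int_absorb1)
  qed
  finally show "emeasure m A = (INF U\<in>{U. A \<subseteq> U \<and> openin (top_of_set I) U}. emeasure m U)" .
qed

lemma content_measure_regular:
  assumes I: "open (I::real set)" and l: "compact_content I l"
  shows "content_measure I l \<in> regular_measures I"
proof (rule regular_measuresI[OF I sets_content_measure[OF I l]])
  fix A assume "A \<in> sets (content_measure I l)"
  then have "A \<in> sets (restrict_space borel I)"
    using I l by simp
  then have "emeasure (content_measure I l) A = outer_content I l A"
    by (rule emeasure_content_measure[OF I l])
  also have "\<dots> = (INF U\<in>{U. A \<subseteq> U \<and> openin (top_of_set I) U}. emeasure (content_measure I l) U)"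
    unfolding outer_content_def using I l
    by (intro INF_cong)
      (auto simp: emeasure_content_measure sets_restrict_borel_iff outer_content_open openin_open_eq)
  finally show "emeasure (content_measure I l) A =
      (INF U\<in>{U. A \<subseteq> U \<and> openin (top_of_set I) U}. emeasure (content_measure I l) U)" .
qed

text \<open>Every regular measure is recovered from its restriction to the compact sets, hence
  \<^const>\<open>content_measure\<close> maps the contents onto the regular measures.\<close>

lemma content_measure_emeasure:
  assumes I: "open I" and m: "m \<in> regular_measures I"
  shows "content_measure I (emeasure m) = m"
proof (rule measure_eqI)
  have sets: "sets m = sets (restrict_space borel I)"
    using m by (simp add: regular_measures_def)
  have l: "compact_content I (emeasure m)"
    using sets by (rule compact_content_measure)
  show "sets (content_measure I (emeasure m)) = sets m"
    unfolding sets by (rule sets_content_measure[OF I l])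
  fix A assume "A \<in> sets (content_measure I (emeasure m))"
  then have A: "A \<in> sets (restrict_space borel I)"
    using I l by simp
  then have "emeasure (content_measure I (emeasure m)) A = outer_content I (emeasure m) A"
    by (rule emeasure_content_measure[OF I l])
  also have "\<dots> = (INF U\<in>{U. A \<subseteq> U \<and> openin (top_of_set I) U}. emeasure m U)"
    unfolding outer_content_def
  proof (rule INF_cong[OF refl])
    fix U assume "U \<in> {U. A \<subseteq> U \<and> openin (top_of_set I) U}"
    then have "U \<in> sets (restrict_space borel I)"
      using I by (auto simp: sets_restrict_borel_iff openin_open_eq)
    then show "inner_content (emeasure m) U = emeasure m U"
      using m unfolding inner_content_def regular_measures_def regular_measure_on_def
      by (elim CollectE conjE) (rule sym, blast)
  qed
  also have "\<dots> = emeasure m A"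
    using m A by (simp add: regular_measures_def regular_measure_on_def)
  finally show "emeasure (content_measure I (emeasure m)) A = emeasure m A" .
qed

section \<open>The topology on regular measures\<close>

lemma regular_measures_sets_iff:
  "m \<in> regular_measures I \<Longrightarrow> open I \<Longrightarrow> A \<in> sets m \<longleftrightarrow> A \<in> sets borel \<and> A \<subseteq> I"
  by (simp add: regular_measures_def sets_restrict_borel_iff)

lemma regular_measures_inner:
  assumes "m \<in> regular_measures I" "A \<in> sets m"
  shows "emeasure m A = (SUP K\<in>{K. K \<subseteq> A \<and> compact K}. emeasure m K)"
  using assms unfolding regular_measures_def regular_measure_on_def by blast

lemma regular_measures_outer:
  assumes "m \<in> regular_measures I" "A \<in> sets m"
  shows "emeasure m A = (INF U\<in>{U. A \<subseteq> U \<and> openin (top_of_set I) U}. emeasure m U)"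
  using assms unfolding regular_measures_def regular_measure_on_def by blast

text \<open>The sets \<open>{m. t < m (a, b)}\<close> and \<open>{m. m [a, b] < t}\<close>, which are open by the two
  semicontinuity requirements. Both are convex.\<close>

definition lower_set :: "real set \<Rightarrow> real \<Rightarrow> real \<Rightarrow> ennreal \<Rightarrow> real measure set" where
  "lower_set I a b t = {m \<in> regular_measures I. t < emeasure m {a<..<b}}"

definition upper_set :: "real set \<Rightarrow> real \<Rightarrow> real \<Rightarrow> ennreal \<Rightarrow> real measure set" where
  "upper_set I a b t = {m \<in> regular_measures I. emeasure m {a..b} < t}"

text \<open>The subbase given by rational interval endpoints and levels from \<open>D\<close>. The set of all
  regular measures is added so that it is visibly the underlying set of the generated topology.\<close>

definition interval_subbase :: "real set \<Rightarrow> ennreal set \<Rightarrow> real measure set set" where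
  "interval_subbase I D = insert (regular_measures I)
     ((\<lambda>(a, b, t). lower_set I a b t) ` {(a, b, t). a \<in> I \<inter> \<rat> \<and> b \<in> I \<inter> \<rat> \<and> a < b \<and> t \<in> D} \<union>
      (\<lambda>(a, b, t). upper_set I a b t) ` {(a, b, t). a \<in> I \<inter> \<rat> \<and> b \<in> I \<inter> \<rat> \<and> a \<le> b \<and> t \<in> D})"

lemma interval_subbaseE:
  assumes "V \<in> interval_subbase I D"
  obtains "V = regular_measures I"
  | a b t where "a \<in> I \<inter> \<rat>" "b \<in> I \<inter> \<rat>" "a < b" "t \<in> D" "V = lower_set I a b t"
  | a b t where "a \<in> I \<inter> \<rat>" "b \<in> I \<inter> \<rat>" "a \<le> b" "t \<in> D" "V = upper_set I a b t"
  using assms unfolding interval_subbase_def by blast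

lemma lower_set_in_subbase:
  "a \<in> I \<inter> \<rat> \<Longrightarrow> b \<in> I \<inter> \<rat> \<Longrightarrow> a < b \<Longrightarrow> t \<in> D \<Longrightarrow> lower_set I a b t \<in> interval_subbase I D"
  unfolding interval_subbase_def by blast

lemma upper_set_in_subbase:
  "a \<in> I \<inter> \<rat> \<Longrightarrow> b \<in> I \<inter> \<rat> \<Longrightarrow> a \<le> b \<Longrightarrow> t \<in> D \<Longrightarrow> upper_set I a b t \<in> interval_subbase I D"
  unfolding interval_subbase_def by blast

lemma countable_interval_subbase:
  assumes "countable D"
  shows "countable (interval_subbase I D)"
proof -
  have "countable (\<rat> \<times> \<rat> \<times> D :: (real \<times> real \<times> ennreal) set)"
    using assms countable_rat by (intro countable_SIGMA)
  then have "countable {(a, b, t). a \<in> I \<inter> \<rat> \<and> b \<in> I \<inter> \<rat> \<and> a < b \<and> t \<in> D}"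
    "countable {(a, b, t). a \<in> I \<inter> \<rat> \<and> b \<in> I \<inter> \<rat> \<and> a \<le> b \<and> t \<in> D}"
    by (rule countable_subset[rotated]; force)+
  then show ?thesis
    unfolding interval_subbase_def by (intro countable_insert countable_Un countable_image)
qed

lemma Union_interval_subbase [simp]: "\<Union>(interval_subbase I D) = regular_measures I"
  unfolding interval_subbase_def lower_set_def upper_set_def by auto

text \<open>A dense set of levels suffices, so that the topology has a countable subbase.\<close>

lemma coarsest_topology_on_interval_subbase:
  assumes dense: "\<And>x y. x < y \<Longrightarrow> \<exists>d\<in>D. x < d \<and> d < y"
  shows "coarsest_topology_on (regular_measures I) (interval_semicontinuous I)
    (topology_generated_by (interval_subbase I D))" (is "coarsest_topology_on _ _ ?X")
  unfolding coarsest_topology_on_def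
proof (intro conjI allI impI)
  show "interval_semicontinuous I ?X"
    unfolding interval_semicontinuous_def lower_semicontinuous_map_def
      upper_semicontinuous_map_def topology_generated_by_topspace Union_interval_subbase
  proof (intro conjI ballI impI allI)
    fix a b t assume ab: "a \<in> I \<inter> \<rat>" "b \<in> I \<inter> \<rat>" "a < b"
    have "{m \<in> regular_measures I. t < emeasure m {a<..<b}} = \<Union>(lower_set I a b ` {d \<in> D. t \<le> d})"
      using dense unfolding lower_set_def by (auto dest: order_le_less_trans) (meson less_imp_le)
    moreover have "openin ?X (\<Union>(lower_set I a b ` {d \<in> D. t \<le> d}))"
      using ab by (intro openin_Union) (auto intro: topology_generated_by_Basis lower_set_in_subbase)
    ultimately show "openin ?X {m \<in> regular_measures I. t < emeasure m {a<..<b}}" by simp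
  next
    fix a b t assume ab: "a \<in> I \<inter> \<rat>" "b \<in> I \<inter> \<rat>" "a \<le> b"
    have "{m \<in> regular_measures I. emeasure m {a..b} < t} = \<Union>(upper_set I a b ` {d \<in> D. d \<le> t})"
      using dense unfolding upper_set_def by (auto dest: order_less_le_trans) (meson less_imp_le)
    moreover have "openin ?X (\<Union>(upper_set I a b ` {d \<in> D. d \<le> t}))"
      using ab by (intro openin_Union) (auto intro: topology_generated_by_Basis upper_set_in_subbase)
    ultimately show "openin ?X {m \<in> regular_measures I. emeasure m {a..b} < t}" by simp
  qed
  fix Y U
  assume Y: "topspace Y = regular_measures I \<and> interval_semicontinuous I Y" and "openin ?X U"
  then have "generate_topology_on (interval_subbase I D) U"
    using openin_topology_generated_by by blast
  then show "openin Y U"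
  proof (induction rule: generate_topology_on.induct)
    case (Basis V)
    then show ?case
    proof (cases rule: interval_subbaseE)
      case 1
      with Y show ?thesis by (metis openin_topspace)
    qed (use Y in \<open>auto simp: interval_semicontinuous_def lower_semicontinuous_map_def
           upper_semicontinuous_map_def lower_set_def upper_set_def\<close>)
  qed auto
qed simp

text \<open>By Tychonoff's theorem, as each defining condition of a content involves finitely many
  coordinates and is closed.\<close>

lemma compact_contents_compact: "compact {l :: 'a::topological_space set \<Rightarrow> ennreal. compact_content I l}"
proof -
  have "compact_space (product_topology (\<lambda>_. euclidean :: ennreal topology) (UNIV :: 'a set set))"
    unfolding compact_space_product_topology
    using compact_UNIV by (auto simp: compact_space_def)
  then have cpt: "compact (UNIV :: ('a set \<Rightarrow> ennreal) set)"
    by (simp add: euclidean_product_topology compact_space_def)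
  have "closed {l :: 'a set \<Rightarrow> ennreal. l {} = 0}"
    by (intro closed_Collect_eq continuous_intros continuous_on_product_coordinates)
  moreover have "closed {l :: 'a set \<Rightarrow> ennreal. compact K \<and> compact L \<and> K \<subseteq> I \<and> L \<subseteq> I \<longrightarrow>
        (K \<subseteq> L \<longrightarrow> l K \<le> l L) \<and> l (K \<union> L) \<le> l K + l L \<and>
        (K \<inter> L = {} \<longrightarrow> l (K \<union> L) = l K + l L)}" for K L
    by (intro closed_Collect_imp closed_Collect_conj closed_Collect_le closed_Collect_eq open_Collect_const
         continuous_on_add continuous_on_product_coordinates)
  ultimately have "closed {l :: 'a set \<Rightarrow> ennreal. compact_content I l}"
    unfolding compact_content_def by (intro closed_Collect_conj closed_Collect_all)
  with cpt show ?thesis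
    using compact_Int_closed by fastforce
qed

lemma closed_interval_margin:
  fixes U :: "real set"
  assumes "open U" "{a..b} \<subseteq> U" "a \<le> b"
  obtains a' b' where "a' < a" "b < b'" "{a'..b'} \<subseteq> U"
proof -
  obtain d where d: "d > 0" "cball a d \<subseteq> U"
    using assms open_contains_cball by (metis atLeastAtMost_iff order_refl subset_iff)
  obtain e where e: "e > 0" "cball b e \<subseteq> U"
    using assms open_contains_cball by (metis atLeastAtMost_iff order_refl subset_iff)
  have "{a - d..b + e} \<subseteq> cball a d \<union> {a..b} \<union> cball b e"
    by (auto simp: cball_def dist_real_def)
  then show ?thesis
    using d e assms that[of "a - d" "b + e"] by auto
qed

text \<open>The masses of compact intervals under \<^const>\<open>content_measure\<close> in terms of single values of the content;
  passing to a slightly larger interval makes the condition open in the content.\<close>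

lemma emeasure_content_measure_closed_interval_less_iff:
  fixes I :: "real set"
  assumes I: "open I" and l: "compact_content I l" and ab: "a \<le> b" "{a..b} \<subseteq> I"
  shows "emeasure (content_measure I l) {a..b} < t \<longleftrightarrow>
    (\<exists>a' b'. a' < a \<and> b < b' \<and> {a'..b'} \<subseteq> I \<and> l {a'..b'} < t)"
proof -
  have eq: "emeasure (content_measure I l) {a..b} = outer_content I l {a..b}"
    using ab I by (intro emeasure_content_measure[OF I l]) (auto simp: sets_restrict_borel_iff)
  show ?thesis
    unfolding eq
  proof safe
    assume "outer_content I l {a..b} < t"
    then obtain U where U: "{a..b} \<subseteq> U" "openin (top_of_set I) U" "inner_content l U < t"
      by (rule outer_content_lessE)
    then have "open U" "U \<subseteq> I" using I by (auto simp: openin_open_eq)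
    obtain a' b' where a': "a' < a" "b < b'" "{a'..b'} \<subseteq> U"
      using closed_interval_margin[OF \<open>open U\<close> U(1) ab(1)] .
    have "l {a'..b'} \<le> inner_content l U"
      using a' by (intro inner_content_upper) auto
    then show "\<exists>a' b'. a' < a \<and> b < b' \<and> {a'..b'} \<subseteq> I \<and> l {a'..b'} < t"
      using a' \<open>U \<subseteq> I\<close> U(3) by (meson order_le_less_trans order_trans)
  next
    fix a' b' assume a': "a' < a" "b < b'" "{a'..b'} \<subseteq> I" "l {a'..b'} < t"
    have "outer_content I l {a..b} \<le> inner_content l {a'<..<b'}"
    proof (rule outer_content_lower)
      show "{a..b} \<subseteq> {a'<..<b'}" using a' by auto
      have "{a'<..<b'} \<subseteq> I" using a'(3) greaterThanLessThan_subseteq_atLeastAtMost_iff by (metis order_refl order_trans)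
      then show "openin (top_of_set I) {a'<..<b'}" using I by (simp add: openin_open_eq)
    qed
    also have "\<dots> \<le> l {a'..b'}"
      unfolding inner_content_def
    proof (rule SUP_least, clarify)
      fix K assume K: "K \<subseteq> {a'<..<b'}" "compact K"
      then have "K \<subseteq> {a'..b'}" by (auto simp: subset_iff less_imp_le)
      then show "l K \<le> l {a'..b'}"
        using l K(2) a'(3) unfolding compact_content_def by (meson compact_Icc order_trans)
    qed
    also have "\<dots> < t" by fact
    finally show "outer_content I l {a..b} < t" .
  qed
qed

lemma continuous_map_content_measure:
  fixes I :: "real set"
  assumes I: "open I" "is_interval I"
  shows "continuous_map (top_of_set {l. compact_content I l})
    (topology_generated_by (interval_subbase I D)) (content_measure I)"
proof (rule continuous_on_generated_topo)
  let ?L = "{l :: real set \<Rightarrow> ennreal. compact_content I l}"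
  fix V assume "V \<in> interval_subbase I D"
  then have "\<exists>O'. open O' \<and> content_measure I -` V \<inter> ?L = ?L \<inter> O'"
  proof (cases rule: interval_subbaseE)
    case 1
    then show ?thesis using I content_measure_regular by (intro exI[of _ UNIV]) auto
  next
    case (2 a b t)
    have sub: "{a<..<b} \<subseteq> I" using 2 I(2) by (auto simp: is_interval_1 less_imp_le)
    have "emeasure (content_measure I l) {a<..<b} = inner_content l {a<..<b}" if "l \<in> ?L" for l
      using that sub I
      by (simp add: emeasure_content_measure sets_restrict_borel_iff outer_content_open openin_open_eq)
    then have "content_measure I -` V \<inter> ?L = ?L \<inter> (\<Union>K\<in>{K. K \<subseteq> {a<..<b} \<and> compact K}. {l. t < l K})"
      using content_measure_regular[OF I(1)] unfolding 2 lower_set_def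
      by (auto simp: less_inner_content_iff) blast
    moreover have "open (\<Union>K\<in>{K. K \<subseteq> {a<..<b} \<and> compact K}. {l :: real set \<Rightarrow> ennreal. t < l K})"
      by (intro open_UN ballI open_Collect_less continuous_on_const continuous_on_product_coordinates)
    ultimately show ?thesis by blast
  next
    case (3 a b t)
    have sub: "{a..b} \<subseteq> I" using 3 I(2) by (auto simp: is_interval_1)
    have "content_measure I -` V \<inter> ?L =
        ?L \<inter> (\<Union>(a', b')\<in>{(a', b'). a' < a \<and> b < b' \<and> {a'..b'} \<subseteq> I}. {l. l {a'..b'} < t})"
      using content_measure_regular[OF I(1)] unfolding 3 upper_set_def
      by (auto simp: emeasure_content_measure_closed_interval_less_iff[OF I(1) _ \<open>a \<le> b\<close> sub]) blast
    moreover have "open (\<Union>(a', b')\<in>{(a', b'). a' < a \<and> b < b' \<and> {a'..b'} \<subseteq> I}. {l :: real set \<Rightarrow> ennreal. l {a'..b'} < t})"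
      unfolding split_def
      by (intro open_UN ballI open_Collect_less continuous_on_const continuous_on_product_coordinates)
    ultimately show ?thesis by blast
  qed
  then show "openin (top_of_set ?L) (content_measure I -` V \<inter> topspace (top_of_set ?L))"
    by (auto simp: openin_open)
next
  show "content_measure I ` topspace (top_of_set {l. compact_content I l}) \<subseteq> \<Union> (interval_subbase I D)"
    using content_measure_regular[OF I(1)] by (auto simp: interval_subbase_def)
qed

lemma compact_space_interval_subbase:
  fixes I :: "real set"
  assumes I: "open I" "is_interval I"
  shows "compact_space (topology_generated_by (interval_subbase I D))" (is "compact_space ?X")
proof -
  let ?L = "{l :: real set \<Rightarrow> ennreal. compact_content I l}"
  have "compactin (top_of_set ?L) ?L"
    using compact_contents_compact[of I] by (simp add: compactin_subtopology)
  then have "compactin ?X (content_measure I ` ?L)"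
    using continuous_map_content_measure[OF I] by (rule image_compactin)
  moreover have "content_measure I ` ?L = regular_measures I"
  proof
    show "content_measure I ` ?L \<subseteq> regular_measures I"
      using content_measure_regular[OF I(1)] by auto
    show "regular_measures I \<subseteq> content_measure I ` ?L"
    proof
      fix m assume m: "m \<in> regular_measures I"
      then have "compact_content I (emeasure m)"
        by (intro compact_content_measure) (simp add: regular_measures_def)
      then show "m \<in> content_measure I ` ?L"
        using content_measure_emeasure[OF I(1) m] by (metis image_eqI mem_Collect_eq)
    qed
  qed
  ultimately show ?thesis by (simp add: compact_space_def)
qed

text \<open>Measures of open sets are compared on the connected components, which are intervals:
  a compact subset of a component lies in a rational open interval whose closure is still
  contained in the component.\<close>

lemma regular_measure_open_le:
  assumes I: "open I" and m: "m \<in> regular_measures I" "m' \<in> regular_measures I"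
    and le: "\<And>a b. a \<in> I \<inter> \<rat> \<Longrightarrow> b \<in> I \<inter> \<rat> \<Longrightarrow> a < b \<Longrightarrow> {a..b} \<subseteq> I \<Longrightarrow>
      emeasure m {a<..<b} \<le> emeasure m' {a..b}"
    and U: "open U" "U \<subseteq> I"
  shows "emeasure m U \<le> emeasure m' U"
proof -
  note m_sets = m[THEN regular_measures_sets_iff, OF I]
  have comp: "emeasure m C \<le> emeasure m' C" if C: "C \<in> components U" for C
  proof -
    have C': "open C" "connected C" "C \<subseteq> I"
      using C U open_components in_components_connected in_components_subset by blast+
    have "emeasure m C = (SUP K\<in>{K. K \<subseteq> C \<and> compact K}. emeasure m K)"
      using C' by (intro regular_measures_inner[OF m(1)]) (auto simp: m_sets)
    also have "\<dots> \<le> emeasure m' C"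
    proof (rule SUP_least, clarify)
      fix K assume K: "K \<subseteq> C" "compact K"
      show "emeasure m K \<le> emeasure m' C"
      proof (cases "K = {}")
        case False
        then obtain x y where xy: "x \<in> K" "y \<in> K" "K \<subseteq> {x..y}"
          using compact_attains_inf[OF K(2)] compact_attains_sup[OF K(2)]
          by (metis atLeastAtMost_iff subsetI)
        have "{x..y} \<subseteq> C"
          using C'(2) xy K connected_contains_Icc by blast
        moreover have "x \<le> y" using xy by auto
        ultimately obtain a' b' where a': "a' < x" "y < b'" "{a'..b'} \<subseteq> C"
          using closed_interval_margin[OF C'(1)] by metis
        obtain a b where ab: "a \<in> \<rat>" "b \<in> \<rat>" "a' < a" "a < x" "y < b" "b < b'"
          using Rats_dense_in_real[OF a'(1)] Rats_dense_in_real[OF a'(2)] by auto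
        have sub: "{a..b} \<subseteq> C" using ab a' by auto
        have "a \<in> C" "b \<in> C" using sub ab \<open>x \<le> y\<close> by auto
        have "K \<subseteq> {a<..<b}" using xy(3) ab by auto
        moreover have "{a<..<b} \<subseteq> I"
          using sub C'(3) by (meson greaterThanLessThan_subseteq_atLeastAtMost_iff order_refl order_trans)
        ultimately have "emeasure m K \<le> emeasure m {a<..<b}"
          by (intro emeasure_mono) (auto simp: m_sets)
        also have "\<dots> \<le> emeasure m' {a..b}"
          using ab sub C'(3) \<open>x \<le> y\<close> \<open>a \<in> C\<close> \<open>b \<in> C\<close> by (intro le) (auto simp del: atLeastAtMost_iff)
        also have "\<dots> \<le> emeasure m' C"
          using sub C' by (intro emeasure_mono) (auto simp: m_sets)
        finally show ?thesis .
      qed simp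
    qed
    finally show ?thesis .
  qed
  have cnt: "countable (components U)"
    using open_components[OF U(1)] pairwise_disjoint_components[of U]
    by (intro countable_disjoint_open_subsets) (auto simp: pairwise_def disjnt_def)
  have sum: "emeasure M U = (\<integral>\<^sup>+C. emeasure M C \<partial>count_space (components U))"
    if "M \<in> regular_measures I" for M
  proof -
    have "emeasure M (\<Union>C\<in>components U. C) = (\<integral>\<^sup>+C. emeasure M C \<partial>count_space (components U))"
    proof (rule emeasure_UN_countable[OF _ cnt])
      show "C \<in> sets M" if "C \<in> components U" for C
        using that U open_components[OF U(1) that] in_components_subset[OF that]
        by (auto simp: regular_measures_sets_iff[OF \<open>M \<in> _\<close> I])
      show "disjoint_family_on (\<lambda>C. C) (components U)"
        using pairwise_disjoint_components by (auto simp: disjoint_family_on_def pairwise_def disjnt_def)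
    qed
    moreover have "(\<Union>C\<in>components U. C) = U"
      unfolding image_ident by (rule Union_components)
    ultimately show ?thesis by metis
  qed
  show ?thesis
    unfolding sum[OF m(1)] sum[OF m(2)] by (intro nn_integral_mono) (auto intro: comp)
qed

lemma Hausdorff_space_interval_subbase:
  fixes I :: "real set"
  assumes I: "open I"
  shows "Hausdorff_space (topology_generated_by (interval_subbase I UNIV))" (is "Hausdorff_space ?X")
proof -
  have sep: "\<exists>U V. openin ?X U \<and> openin ?X V \<and> m' \<in> U \<and> m \<in> V \<and> disjnt U V"
    if m: "m \<in> regular_measures I" "m' \<in> regular_measures I"
      and ab: "a \<in> I \<inter> \<rat>" "b \<in> I \<inter> \<rat>" "a < b" "{a..b} \<subseteq> I" "emeasure m' {a..b} < emeasure m {a<..<b}"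
    for m m' a b
  proof -
    obtain t where t: "emeasure m' {a..b} < t" "t < emeasure m {a<..<b}"
      using dense[OF ab(5)] by blast
    have "openin ?X (upper_set I a b t)" "openin ?X (lower_set I a b t)"
      using ab by (auto intro!: topology_generated_by_Basis upper_set_in_subbase lower_set_in_subbase)
    moreover have "m' \<in> upper_set I a b t" "m \<in> lower_set I a b t"
      using m t by (auto simp: upper_set_def lower_set_def)
    moreover have "disjnt (upper_set I a b t) (lower_set I a b t)"
      unfolding disjnt_iff
    proof (intro allI notI, elim conjE)
      fix n assume n: "n \<in> upper_set I a b t" "n \<in> lower_set I a b t"
      then have nM: "n \<in> regular_measures I" by (simp add: upper_set_def)
      have "emeasure n {a<..<b} \<le> emeasure n {a..b}"
        using ab(4) by (intro emeasure_mono) (auto simp: regular_measures_sets_iff[OF nM I])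
      with n show False by (auto simp: upper_set_def lower_set_def dest: order_less_trans)
    qed
    ultimately show ?thesis by blast
  qed
  show ?thesis
    unfolding Hausdorff_space_def topology_generated_by_topspace Union_interval_subbase
  proof (intro allI impI, elim conjE)
    fix m m' assume m: "m \<in> regular_measures I" "m' \<in> regular_measures I" and "m \<noteq> m'"
    have eq: "sets m = sets (restrict_space borel I)" "sets m' = sets (restrict_space borel I)"
      using m by (auto simp: regular_measures_def)
    obtain A where A: "A \<in> sets (restrict_space borel I)" "emeasure m A \<noteq> emeasure m' A"
      using \<open>m \<noteq> m'\<close> measure_eqI[of m m'] eq by auto
    obtain U where U: "open U" "U \<subseteq> I" "emeasure m U \<noteq> emeasure m' U"
    proof (rule ccontr)
      assume "\<not> thesis"
      with that have "emeasure m U = emeasure m' U" if "open U" "U \<subseteq> I" for U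
        using \<open>open U\<close> \<open>U \<subseteq> I\<close> by blast
      then have "(INF U\<in>{U. A \<subseteq> U \<and> openin (top_of_set I) U}. emeasure m U) =
          (INF U\<in>{U. A \<subseteq> U \<and> openin (top_of_set I) U}. emeasure m' U)"
        using I by (intro INF_cong) (auto simp: openin_open_eq)
      with A show False
        using regular_measures_outer[OF m(1), of A] regular_measures_outer[OF m(2), of A] eq by auto
    qed
    then consider "\<not> emeasure m U \<le> emeasure m' U" | "\<not> emeasure m' U \<le> emeasure m U" by fastforce
    then show "\<exists>U V. openin ?X U \<and> openin ?X V \<and> m \<in> U \<and> m' \<in> V \<and> disjnt U V"
    proof cases
      case 1
      then obtain a b where "a \<in> I \<inter> \<rat>" "b \<in> I \<inter> \<rat>" "a < b" "{a..b} \<subseteq> I"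
          "emeasure m' {a..b} < emeasure m {a<..<b}"
        using regular_measure_open_le[OF I m _ U(1,2)] by (meson not_le)
      from sep[OF m this] show ?thesis by (metis disjnt_sym)
    next
      case 2
      then obtain a b where "a \<in> I \<inter> \<rat>" "b \<in> I \<inter> \<rat>" "a < b" "{a..b} \<subseteq> I"
          "emeasure m {a..b} < emeasure m' {a<..<b}"
        using regular_measure_open_le[OF I m(2,1) _ U(1,2)] by (meson not_le)
      from sep[OF m(2,1) this] show ?thesis by (metis disjnt_sym)
    qed
  qed
qed

section \<open>Partitions of unity and mixtures of measures\<close>

text \<open>A countable convex combination of numbers above \<open>t\<close> is above \<open>t\<close>. Only terms of positive
  weight matter.\<close>

lemma convex_series_less:
  fixes w h :: "nat \<Rightarrow> real"
  assumes w: "\<And>i. 0 \<le> w i" "w sums 1" and wh: "summable (\<lambda>i. w i * h i)"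
    and less: "\<And>i. 0 < w i \<Longrightarrow> t < h i"
  shows "t < (\<Sum>i. w i * h i)"
proof -
  have "\<exists>i. 0 < w i"
  proof (rule ccontr)
    assume "\<nexists>i. 0 < w i"
    with w(1) have "w = (\<lambda>_. 0)" by (auto simp: fun_eq_iff not_less intro: antisym)
    with w(2) show False by (simp add: sums_iff)
  qed
  then obtain i where i: "0 < w i" ..
  have tw: "(\<lambda>i. t * w i) sums t" using sums_mult[OF w(2), of t] by simp
  have eq: "w i * (h i - t) = w i * h i - t * w i" for i by (simp add: algebra_simps)
  have sums: "(\<lambda>i. w i * (h i - t)) sums ((\<Sum>i. w i * h i) - t)"
    unfolding eq using summable_sums[OF wh] tw by (rule sums_diff)
  have "0 \<le> w i * (h i - t)" for i
  proof (cases "w i = 0")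
    case False
    with w(1)[of i] have "0 < w i" by simp
    then show ?thesis using less[of i] by simp
  qed simp
  moreover have "0 < w i * (h i - t)" using i less[OF i] by simp
  ultimately have "0 < (\<Sum>i. w i * (h i - t))"
    using sums by (intro suminf_pos2) (auto simp: sums_iff)
  then show ?thesis using sums by (simp add: sums_iff)
qed

context Metric_space
begin

text \<open>A countable partition of unity on the complement of a closed set \<open>A\<close> with a dense sequence
  \<open>a\<close>. With \<open>\<delta> x\<close> the distance from \<open>x\<close> to \<open>A\<close>, the weight of \<open>a i\<close> at \<open>x\<close> is proportional to
  \<open>c i * max 0 (2 * \<delta> x - d x (a i))\<close>; it vanishes unless \<open>a i\<close> is less than twice as far from \<open>x\<close>
  as \<open>A\<close> is.
  The factors \<open>c\<close> are arbitrary and serve to make the series with coefficients \<open>h\<close> converge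
  locally uniformly. Everything is Lipschitz before normalization, which gives continuity.\<close>

lemma dugundji_weights:
  fixes a :: "nat \<Rightarrow> 'a" and c :: "nat \<Rightarrow> real"
  assumes A: "closedin mtopology A" and a: "range a \<subseteq> A"
    and dense: "\<And>z e. z \<in> A \<Longrightarrow> 0 < e \<Longrightarrow> \<exists>i. d z (a i) < e"
    and c: "\<And>i. 0 < c i" "\<And>i. c i \<le> (1/2)^i"
  obtains w :: "nat \<Rightarrow> 'a \<Rightarrow> real" where
    "\<And>i x. x \<in> M - A \<Longrightarrow> 0 \<le> w i x"
    "\<And>x. x \<in> M - A \<Longrightarrow> (\<lambda>i. w i x) sums 1"
    "\<And>i x z. x \<in> M - A \<Longrightarrow> z \<in> A \<Longrightarrow> 0 < w i x \<Longrightarrow> d z (a i) < 3 * d x z"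
    "\<And>h x. (\<And>i. 0 \<le> h i \<and> c i * h i \<le> (1/2)^i) \<Longrightarrow> x \<in> M - A \<Longrightarrow> summable (\<lambda>i. w i x * h i)"
    "\<And>h. (\<And>i. 0 \<le> h i \<and> c i * h i \<le> (1/2)^i) \<Longrightarrow>
       continuous_map (subtopology mtopology (M - A)) euclideanreal (\<lambda>x. \<Sum>i. w i x * h i)"
proof -
  have AM: "A \<subseteq> M" using closedin_subset[OF A] by simp
  have aM: "a i \<in> M" and aA: "a i \<in> A" for i using a AM by auto
  define \<delta> where "\<delta> x = (INF i. d x (a i))" for x
  define u where "u i x = max 0 (2 * \<delta> x - d x (a i))" for i x
  have bdd: "bdd_below (range (\<lambda>i. d x (a i)))" for x
    by (rule bdd_belowI[of _ 0]) auto
  have \<delta>_le: "\<delta> x \<le> d x (a i)" for x i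
    unfolding \<delta>_def by (rule cINF_lower[OF bdd]) simp
  have \<delta>_Lip: "\<delta> x \<le> \<delta> y + d x y" if "x \<in> M" "y \<in> M" for x y
  proof -
    have "\<delta> x - d x y \<le> \<delta> y"
      unfolding \<delta>_def[of y]
    proof (rule cINF_greatest)
      fix i
      have "\<delta> x \<le> d x y + d y (a i)"
        using \<delta>_le[of x i] triangle[OF that aM[of i]] by linarith
      then show "\<delta> x - d x y \<le> d y (a i)" by simp
    qed simp
    then show ?thesis by simp
  qed
  have \<delta>_pos: "0 < \<delta> x" if x: "x \<in> M - A" for x
  proof -
    have "openin mtopology (M - A)" using A by (metis closedin_def topspace_mtopology)
    then obtain r where r: "0 < r" "mball x r \<subseteq> M - A"
      using x unfolding openin_mtopology by blast
    have "r \<le> \<delta> x"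
      unfolding \<delta>_def
    proof (rule cINF_greatest)
      fix i
      show "r \<le> d x (a i)"
        using r(2) aA[of i] aM[of i] that by (force simp: subset_iff not_less)
    qed simp
    with r show ?thesis by simp
  qed
  have \<delta>_near: "\<delta> x \<le> d x z" if "x \<in> M" "z \<in> A" for x z
  proof (rule field_le_epsilon)
    fix e :: real assume "0 < e"
    then obtain i where "d z (a i) < e" using dense \<open>z \<in> A\<close> by blast
    moreover have "d x (a i) \<le> d x z + d z (a i)"
      using that AM aM by (intro triangle) auto
    ultimately show "\<delta> x \<le> d x z + e" using \<delta>_le[of x i] by linarith
  qed
  have u_nonneg: "0 \<le> u i x" for i x by (simp add: u_def)
  have u_le: "u i x \<le> \<delta> x" if "x \<in> M" for i x
  proof -
    have "0 \<le> \<delta> x" unfolding \<delta>_def by (rule cINF_greatest) auto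
    with \<delta>_le[of x i] show ?thesis by (simp add: u_def)
  qed
  have u_Lip: "u i x - u i y \<le> 3 * d x y" if "x \<in> M" "y \<in> M" for i x y
  proof -
    have "2 * \<delta> x - d x (a i) \<le> 2 * \<delta> y - d y (a i) + 3 * d x y"
      using \<delta>_Lip[OF that] triangle[OF that(2) that(1) aM[of i]] commute[of x y] by linarith
    then show ?thesis
      using nonneg[of x y] unfolding u_def max_def by (smt (verit))
  qed
  have half: "(\<lambda>i. (1/2::real)^i) sums 2" using geometric_sums[of "1/2::real"] by simp
  define G where "G k x = (\<Sum>i. u i x * k i)" for k x
  define good where "good k \<longleftrightarrow> (\<forall>i. 0 \<le> k i \<and> k i \<le> (1/2::real)^i)" for k
  have G_summable: "summable (\<lambda>i. u i x * k i)" if "good k" "x \<in> M" for k x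
  proof (rule summable_comparison_test)
    show "\<exists>N. \<forall>n\<ge>N. norm (u n x * k n) \<le> \<delta> x * (1/2)^n"
    proof (intro exI allI impI)
      fix n
      have "u n x * k n \<le> \<delta> x * (1/2)^n"
        using that u_le[OF that(2)] u_nonneg[of n x] by (intro mult_mono) (auto simp: good_def intro: order_trans)
      then show "norm (u n x * k n) \<le> \<delta> x * (1/2)^n"
        using that u_nonneg[of n x] by (auto simp: good_def)
    qed
    show "summable (\<lambda>n. \<delta> x * (1/2)^n)"
      using half by (intro summable_mult) (simp add: sums_iff)
  qed
  \<comment> \<open>The functions \<open>u i\<close> are Lipschitz with constant 3 and the coefficients sum to at most 2.\<close>
  have G_Lip: "G k x - G k y \<le> 6 * d x y" if k: "good k" and xy: "x \<in> M" "y \<in> M" for k x y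
  proof -
    have "G k x - G k y = (\<Sum>i. u i x * k i - u i y * k i)"
      unfolding G_def using k xy by (intro suminf_diff G_summable)
    also have "\<dots> \<le> (\<Sum>i. 3 * d x y * (1/2)^i)"
    proof (rule suminf_le)
      fix i
      have "u i x * k i - u i y * k i = (u i x - u i y) * k i" by (simp add: algebra_simps)
      also have "\<dots> \<le> 3 * d x y * k i"
        using u_Lip[OF xy] k by (intro mult_right_mono) (auto simp: good_def)
      also have "\<dots> \<le> 3 * d x y * (1/2)^i"
        using k by (intro mult_left_mono) (auto simp: good_def)
      finally show "u i x * k i - u i y * k i \<le> 3 * d x y * (1/2)^i" .
    qed (use k xy half in \<open>auto intro!: summable_diff G_summable summable_mult simp: sums_iff\<close>)
    also have "\<dots> = 3 * d x y * 2"
      using half by (subst suminf_mult) (auto simp: sums_iff)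
    finally show ?thesis by simp
  qed
  have G_cont: "continuous_map mtopology euclideanreal (G k)" if k: "good k" for k
  proof -
    have "\<bar>G k x - G k y\<bar> \<le> 6 * d x y" if "x \<in> M" "y \<in> M" for x y
      using G_Lip[OF k that] G_Lip[OF k that(2) that(1)] commute[of x y] by (simp add: abs_le_iff)
    then have "Lipschitz_continuous_map (metric (M, d)) euclidean_metric (G k)"
      unfolding Lipschitz_continuous_map_def by (auto simp: dist_real_def intro!: exI[of _ 6])
    then show ?thesis
      using Lipschitz_continuous_imp_continuous_map by fastforce
  qed
  have c_good: "good c" using c by (auto simp: good_def intro: less_imp_le)
  define S where "S = G c"
  \<comment> \<open>Some \<open>a i\<close> lies within twice the distance from \<open>x\<close> to \<open>A\<close>, so not all weights vanish.\<close>
  have S_pos: "0 < S x" if x: "x \<in> M - A" for x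
  proof -
    have "\<exists>i. d x (a i) < 2 * \<delta> x"
    proof (rule ccontr)
      assume "\<nexists>i. d x (a i) < 2 * \<delta> x"
      then have "2 * \<delta> x \<le> \<delta> x"
        unfolding \<delta>_def[of x] by (intro cINF_greatest) (auto simp: not_less)
      with \<delta>_pos[OF x] show False by simp
    qed
    then obtain i where "d x (a i) < 2 * \<delta> x" ..
    then have "0 < u i x" by (simp add: u_def)
    then show ?thesis
      unfolding S_def G_def using x c(1) u_nonneg
      by (intro suminf_pos2[of _ i] G_summable c_good)
        (auto intro!: mult_nonneg_nonneg less_imp_le[OF c(1)])
  qed
  define w where "w i x = u i x * c i / S x" for i x
  have wh: "w i x * h i = u i x * (c i * h i) / S x" for i x h
    by (simp add: w_def)
  have h_good: "good (\<lambda>i. c i * h i)" if "\<And>i. 0 \<le> h i \<and> c i * h i \<le> (1/2)^i" for h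
    using that by (auto simp: good_def intro!: mult_nonneg_nonneg less_imp_le[OF c(1)])
  show ?thesis
  proof (rule that[of w])
    show "0 \<le> w i x" if "x \<in> M - A" for i x
      using S_pos[OF that] u_nonneg[of i x] c(1)[of i] by (simp add: w_def)
    show "(\<lambda>i. w i x) sums 1" if "x \<in> M - A" for x
    proof -
      have "(\<lambda>i. u i x * c i) sums S x"
        unfolding S_def G_def using that by (intro summable_sums G_summable c_good) auto
      then have "(\<lambda>i. u i x * c i / S x) sums (S x / S x)" by (rule sums_divide)
      then show ?thesis using S_pos[OF that] by (simp add: w_def)
    qed
    show "d z (a i) < 3 * d x z" if "x \<in> M - A" "z \<in> A" "0 < w i x" for i x z
    proof -
      have "0 < u i x"
        using that S_pos[OF that(1)] c(1)[of i] u_nonneg[of i x]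
        by (auto simp: w_def zero_less_divide_iff zero_less_mult_iff)
      then have "d x (a i) < 2 * \<delta> x" by (auto simp: u_def max_def split: if_splits)
      also have "\<dots> \<le> 2 * d x z" using \<delta>_near that by simp
      finally have "d x (a i) < 2 * d x z" .
      moreover have "d z (a i) \<le> d z x + d x (a i)"
        using that AM aM by (intro triangle) auto
      ultimately show ?thesis using commute[of x z] by simp
    qed
    show "summable (\<lambda>i. w i x * h i)"
      if h: "\<And>i. 0 \<le> h i \<and> c i * h i \<le> (1/2)^i" and x: "x \<in> M - A" for h x
      unfolding wh using x by (intro summable_divide G_summable h_good h) auto
    show "continuous_map (subtopology mtopology (M - A)) euclideanreal (\<lambda>x. \<Sum>i. w i x * h i)"
      if h: "\<And>i. 0 \<le> h i \<and> c i * h i \<le> (1/2)^i" for h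
    proof -
      have eq: "(\<Sum>i. w i x * h i) = G (\<lambda>i. c i * h i) x / S x" if "x \<in> M - A" for x
        unfolding wh G_def using that
        by (intro suminf_divide G_summable h_good h) auto
      have "continuous_map (subtopology mtopology (M - A)) euclideanreal
          (\<lambda>x. G (\<lambda>i. c i * h i) x / S x)"
        unfolding S_def using S_pos
        by (intro continuous_map_real_divide continuous_map_from_subtopology G_cont c_good h_good h)
          (force simp: S_def)
      then show ?thesis
        by (rule continuous_map_eq) (simp add: eq)
    qed
  qed
qed

end

text \<open>The sets in \<open>\<G>\<close> divide the space into finitely many cells. Placing in each nonempty cell
  a point mass equal to the measure of the cell, cut off at \<open>N\<close>, yields a finite measure that
  agrees with \<open>m\<close> on each member of \<open>\<G>\<close> all of whose cells have measure at most \<open>N\<close>, and that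
  is at least \<open>N\<close> on the others.\<close>

lemma finitely_supported_approximation:
  fixes N :: real
  assumes fin: "finite \<G>" and \<G>: "\<G> \<subseteq> sets m"
  obtains \<nu> where "sets \<nu> = sets m" "emeasure \<nu> (space \<nu>) \<noteq> \<infinity>"
    "\<And>B. B \<in> \<G> \<Longrightarrow> emeasure \<nu> B \<le> emeasure m B"
    "\<And>B. B \<in> \<G> \<Longrightarrow> min (emeasure m B) N \<le> emeasure \<nu> B"
proof -
  define cell where "cell S = {x \<in> space m. \<forall>B\<in>\<G>. x \<in> B \<longleftrightarrow> B \<in> S}" for S
  define J where "J = {S \<in> Pow \<G>. cell S \<noteq> {}}"
  define p where "p S = (SOME x. x \<in> cell S)" for S
  define weight where "weight S = min (emeasure m (cell S)) (ennreal N)" for S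
  define \<nu> where "\<nu> = distr (point_measure J weight) m p"
  have J: "finite J" using fin by (simp add: J_def)
  have p: "p S \<in> cell S" if "S \<in> J" for S
    using that unfolding p_def J_def by (auto intro: someI)
  have pm: "p \<in> measurable (point_measure J weight) m"
    using J p by (auto simp: cell_def)
  have cell_sets: "cell S \<in> sets m" for S
  proof -
    have "cell S = {x \<in> space m. \<forall>B\<in>\<G>. x \<in> (if B \<in> S then B else space m - B)}"
      by (auto simp: cell_def)
    also have "\<dots> \<in> sets m"
    proof (rule sets.sets_Collect_finite_All[OF _ fin])
      fix B assume "B \<in> \<G>"
      then have "{x \<in> space m. x \<in> (if B \<in> S then B else space m - B)} = (if B \<in> S then B else space m - B)"
        using \<G> sets.sets_into_space by auto
      then show "{x \<in> space m. x \<in> (if B \<in> S then B else space m - B)} \<in> sets m"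
        using \<open>B \<in> \<G>\<close> \<G> by (auto split: if_splits)
    qed
    finally show ?thesis .
  qed
  have \<nu>_emeasure: "emeasure \<nu> B = (\<Sum>S\<in>{S \<in> J. p S \<in> B}. weight S)" if "B \<in> sets m" for B
  proof -
    have "emeasure \<nu> B = emeasure (point_measure J weight) {S \<in> J. p S \<in> B}"
      unfolding \<nu>_def using that pm
      by (subst emeasure_distr) (auto simp: space_point_measure intro!: arg_cong2[where f=emeasure])
    also have "\<dots> = (\<Sum>S\<in>{S \<in> J. p S \<in> B}. weight S)"
      using J by (intro emeasure_point_measure_finite) auto
    finally show ?thesis .
  qed
  have \<nu>_B: "emeasure \<nu> B = (\<Sum>S\<in>{S \<in> J. B \<in> S}. weight S)"
    and m_B: "emeasure m B = (\<Sum>S\<in>{S \<in> J. B \<in> S}. emeasure m (cell S))" if B: "B \<in> \<G>" for B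
  proof -
    have "p S \<in> B \<longleftrightarrow> B \<in> S" if "S \<in> J" for S
      using p[OF that] B by (simp add: cell_def)
    then have "{S \<in> J. p S \<in> B} = {S \<in> J. B \<in> S}" by blast
    then show "emeasure \<nu> B = (\<Sum>S\<in>{S \<in> J. B \<in> S}. weight S)"
      using \<nu>_emeasure[of B] B \<G> by auto
    have "B = (\<Union>S\<in>{S \<in> J. B \<in> S}. cell S)"
    proof (intro antisym subsetI)
      fix x assume x: "x \<in> B"
      then have "x \<in> cell {C \<in> \<G>. x \<in> C}"
        using B \<G> sets.sets_into_space by (auto simp: cell_def)
      then show "x \<in> (\<Union>S\<in>{S \<in> J. B \<in> S}. cell S)"
        using x B by (auto simp: J_def intro!: exI[of _ "{C \<in> \<G>. x \<in> C}"])
    qed (use B in \<open>auto simp: cell_def\<close>)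
    moreover have "emeasure m (\<Union>S\<in>{S \<in> J. B \<in> S}. cell S) = (\<Sum>S\<in>{S \<in> J. B \<in> S}. emeasure m (cell S))"
    proof (rule sum_emeasure[symmetric])
      show "disjoint_family_on cell {S \<in> J. B \<in> S}"
        unfolding disjoint_family_on_def
      proof (intro ballI impI)
        fix S T assume "S \<in> {S \<in> J. B \<in> S}" "T \<in> {S \<in> J. B \<in> S}" "S \<noteq> T"
        then have "S \<subseteq> \<G>" "T \<subseteq> \<G>" by (auto simp: J_def)
        with \<open>S \<noteq> T\<close> show "cell S \<inter> cell T = {}" by (auto simp: cell_def)
      qed
    qed (use J cell_sets in auto)
    ultimately show "emeasure m B = (\<Sum>S\<in>{S \<in> J. B \<in> S}. emeasure m (cell S))" by simp
  qed
  show ?thesis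
  proof (rule that[of \<nu>])
    show sets: "sets \<nu> = sets m" by (simp add: \<nu>_def)
    have "emeasure \<nu> (space m) = (\<Sum>S\<in>{S \<in> J. p S \<in> space m}. weight S)"
      by (rule \<nu>_emeasure) simp
    also have "\<dots> < \<infinity>" using J by (auto simp: weight_def min_less_iff_disj)
    finally show "emeasure \<nu> (space \<nu>) \<noteq> \<infinity>"
      using sets_eq_imp_space_eq[OF sets] by simp
    fix B assume B: "B \<in> \<G>"
    show "emeasure \<nu> B \<le> emeasure m B"
      unfolding \<nu>_B[OF B] m_B[OF B] by (rule sum_mono) (simp add: weight_def)
    show "min (emeasure m B) N \<le> emeasure \<nu> B"
    proof (cases "\<exists>S\<in>{S \<in> J. B \<in> S}. ennreal N \<le> emeasure m (cell S)")
      case True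
      then obtain S where S: "S \<in> {S \<in> J. B \<in> S}" "ennreal N \<le> emeasure m (cell S)" by blast
      have "ennreal N = weight S" using S by (simp add: weight_def min_def)
      also have "\<dots> \<le> emeasure \<nu> B"
        unfolding \<nu>_B[OF B] using S J by (intro member_le_sum) auto
      finally show ?thesis by (simp add: min_le_iff_disj)
    next
      case False
      then have "emeasure m B = emeasure \<nu> B"
        unfolding \<nu>_B[OF B] m_B[OF B] by (intro sum.cong) (auto simp: weight_def min_def)
      then show ?thesis by simp
    qed
  qed
qed

lemma ex_countable_mixture:
  fixes \<nu> :: "nat \<Rightarrow> 'a measure" and w :: "nat \<Rightarrow> ennreal"
  assumes sets: "\<And>i. sets (\<nu> i) = sets M"
  obtains \<mu> where "sets \<mu> = sets M"
    "\<And>A. A \<in> sets M \<Longrightarrow> emeasure \<mu> A = (\<Sum>i. w i * emeasure (\<nu> i) A)"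
proof -
  define f where "f A = (\<Sum>i. w i * emeasure (\<nu> i) A)" for A
  have "countably_additive (sets M) f"
    unfolding countably_additive_def
  proof (intro allI impI)
    fix A :: "nat \<Rightarrow> 'a set"
    assume A: "range A \<subseteq> sets M" "disjoint_family A"
    have "(\<Sum>n. f (A n)) = (\<integral>\<^sup>+i. (\<Sum>n. w i * emeasure (\<nu> i) (A n)) \<partial>count_space UNIV)"
      unfolding f_def by (subst nn_integral_suminf) (auto simp: nn_integral_count_space_nat)
    also have "\<dots> = (\<Sum>i. w i * (\<Sum>n. emeasure (\<nu> i) (A n)))"
      by (simp add: nn_integral_count_space_nat)
    also have "\<dots> = f (\<Union>(range A))"
      unfolding f_def using A sets by (subst suminf_emeasure) auto
    finally show "(\<Sum>n. f (A n)) = f (\<Union>(range A))" .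
  qed
  then have ms: "measure_space (space M) (sets M) f"
    using sets.sigma_algebra_axioms[of M] by (auto simp: measure_space_def positive_def f_def)
  show ?thesis
  proof (rule that[of "measure_of (space M) (sets M) f"])
    show "sets (measure_of (space M) (sets M) f) = sets M" by simp
    show "emeasure (measure_of (space M) (sets M) f) A = (\<Sum>i. w i * emeasure (\<nu> i) A)" if "A \<in> sets M" for A
      using ms that unfolding f_def[symmetric]
      by (intro emeasure_measure_of_sigma) (auto simp: measure_space_def)
  qed
qed

section \<open>Extension of maps into the space of measures\<close>

lemma rational_interval_sets:
  fixes I :: "real set"
  assumes "open I" "is_interval I" "a \<in> I" "b \<in> I"
  shows "{a<..<b} \<in> sets (restrict_space borel I)" "{a..b} \<in> sets (restrict_space borel I)"
proof -
  have "{a..b} \<subseteq> I"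
    using mem_is_interval_1_I[OF assms(2-4)] by auto
  moreover from this have "{a<..<b} \<subseteq> I"
    by (meson greaterThanLessThan_subseteq_atLeastAtMost_iff order_refl order_trans)
  ultimately show "{a<..<b} \<in> sets (restrict_space borel I)" "{a..b} \<in> sets (restrict_space borel I)"
    using assms(1) by (simp_all add: sets_restrict_borel_iff)
qed

text \<open>A basic neighbourhood of \<open>m\<close> constrains the masses of finitely many intervals: each is
  bounded below by a level less than its \<open>m\<close>-mass, or above by a level greater than it. Both kinds
  of constraint hold for measures whose masses lie between those of \<open>m\<close> cut off at some large \<open>N\<close>
  and those of \<open>m\<close>.\<close>

lemma finite_measures_dense:
  assumes I: "open I" "is_interval I"
    and V: "openin (topology_generated_by (interval_subbase I UNIV)) V" "V \<noteq> {}"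
  shows "\<exists>\<nu>\<in>V. emeasure \<nu> I \<noteq> \<infinity>"
proof -
  obtain m where m: "m \<in> V" using V(2) by blast
  obtain \<F> where \<F>: "finite \<F>" "\<F> \<noteq> {}" "\<F> \<subseteq> interval_subbase I UNIV" "m \<in> \<Inter>\<F>" "\<Inter>\<F> \<subseteq> V"
    using generated_topology_local_base[OF V(1) m] .
  have mM: "m \<in> regular_measures I"
    using V(1) m openin_subset by fastforce
  then have sets: "sets m = sets (restrict_space borel I)" by (simp add: regular_measures_def)
  \<comment> \<open>The pair \<open>p\<close> consists of the interval that \<open>S\<close> constrains and of a sufficient cut-off.\<close>
  have "\<forall>S\<in>\<F>. \<exists>p. fst p \<in> sets m \<and> (\<forall>N\<ge>snd p. \<forall>\<nu>\<in>regular_measures I.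
      emeasure \<nu> (fst p) \<le> emeasure m (fst p) \<longrightarrow>
      min (emeasure m (fst p)) (ennreal N) \<le> emeasure \<nu> (fst p) \<longrightarrow> \<nu> \<in> S)"
    (is "\<forall>S\<in>\<F>. \<exists>p. ?Q S p")
  proof
    fix S assume S: "S \<in> \<F>"
    then have "S \<in> interval_subbase I UNIV" "m \<in> S" using \<F> by auto
    then show "\<exists>p. ?Q S p"
    proof (cases rule: interval_subbaseE)
      case 1
      then show ?thesis by (intro exI[of _ "({}, 0)"]) auto
    next
      case (2 a b t)
      have B: "{a<..<b} \<in> sets m" using 2 I sets by (simp add: rational_interval_sets)
      have tm: "t < emeasure m {a<..<b}" using \<open>m \<in> S\<close> 2 by (simp add: lower_set_def)
      then have "t < top" using less_top_ennreal order_less_le_trans top_greatest by blast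
      then obtain r where r: "0 \<le> r" "t = ennreal r" by (cases t) auto
      have "\<nu> \<in> S" if "r + 1 \<le> N" "\<nu> \<in> regular_measures I"
        "min (emeasure m {a<..<b}) (ennreal N) \<le> emeasure \<nu> {a<..<b}" for N \<nu>
      proof -
        have "t < ennreal N" using that r by (simp add: ennreal_less_iff)
        with tm that(3) have "t < emeasure \<nu> {a<..<b}" by (meson min_less_iff_conj order_less_le_trans)
        with that(2) 2 show ?thesis by (simp add: lower_set_def)
      qed
      with B show ?thesis by (intro exI[of _ "({a<..<b}, r + 1)"]) auto
    next
      case (3 a b t)
      have B: "{a..b} \<in> sets m" using 3 I sets by (simp add: rational_interval_sets)
      have "\<nu> \<in> S" if "\<nu> \<in> regular_measures I" "emeasure \<nu> {a..b} \<le> emeasure m {a..b}" for \<nu>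
        using that \<open>m \<in> S\<close> 3 by (auto simp: upper_set_def)
      with B show ?thesis by (intro exI[of _ "({a..b}, 0)"]) auto
    qed
  qed
  then obtain p where p: "\<forall>S\<in>\<F>. ?Q S (p S)"
    by (rule bchoice[THEN exE])
  define N where "N = Max ((\<lambda>S. snd (p S)) ` \<F>)"
  obtain \<nu> where \<nu>: "sets \<nu> = sets m" "emeasure \<nu> (space \<nu>) \<noteq> \<infinity>"
    "\<And>B. B \<in> (\<lambda>S. fst (p S)) ` \<F> \<Longrightarrow> emeasure \<nu> B \<le> emeasure m B"
    "\<And>B. B \<in> (\<lambda>S. fst (p S)) ` \<F> \<Longrightarrow> min (emeasure m B) N \<le> emeasure \<nu> B"
    using finitely_supported_approximation[of "(\<lambda>S. fst (p S)) ` \<F>" m N] p \<F>(1) by blast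
  have sp: "space \<nu> = I"
    using sets_eq_imp_space_eq[of \<nu> "restrict_space borel I"] \<nu>(1) sets by (simp add: space_restrict_space)
  have \<nu>M: "\<nu> \<in> regular_measures I"
    using finite_imp_regular_measures[OF I(1)] \<nu> sets sp by simp
  have "\<nu> \<in> S" if S: "S \<in> \<F>" for S
  proof -
    have "snd (p S) \<le> N" unfolding N_def using \<F>(1) S by (intro Max_ge) auto
    then show ?thesis using p S \<nu>(3,4) \<nu>M by blast
  qed
  then show ?thesis using \<F>(5) \<nu>(2) sp by blast
qed

lemma dense_sequence_of_finite_measures:
  assumes I: "open I" "is_interval I" and "second_countable (topology_generated_by (interval_subbase I UNIV))"
  obtains \<nu> :: "nat \<Rightarrow> real measure" where
    "\<And>n. \<nu> n \<in> regular_measures I" "\<And>n. emeasure (\<nu> n) I \<noteq> \<infinity>"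
    "\<And>V. openin (topology_generated_by (interval_subbase I UNIV)) V \<Longrightarrow> V \<noteq> {} \<Longrightarrow> \<exists>n. \<nu> n \<in> V"
proof -
  let ?X = "topology_generated_by (interval_subbase I UNIV)"
  obtain B where B: "countable B" "\<And>V. V \<in> B \<Longrightarrow> openin ?X V"
      "\<And>U x. openin ?X U \<Longrightarrow> x \<in> U \<Longrightarrow> \<exists>V\<in>B. x \<in> V \<and> V \<subseteq> U"
    using assms(3) unfolding second_countable_def by (elim exE conjE) simp
  define B' where "B' = insert (regular_measures I) (B - {{}})"
  have "null_measure (restrict_space borel I) \<in> regular_measures I"
    by (rule finite_imp_regular_measures[OF I(1)]) auto
  then have ne: "regular_measures I \<noteq> {}" by blast
  have B': "countable B'" "B' \<noteq> {}" using B(1) by (auto simp: B'_def)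
  have "\<exists>\<nu>\<in>V. emeasure \<nu> I \<noteq> \<infinity>" if "V \<in> B'" for V
  proof (rule finite_measures_dense[OF I])
    have "openin ?X (regular_measures I)"
      by (intro topology_generated_by_Basis) (simp add: interval_subbase_def)
    then show "openin ?X V" using that B(2) by (auto simp: B'_def)
    show "V \<noteq> {}" using that ne by (auto simp: B'_def)
  qed
  then have "\<forall>n. \<exists>\<nu>. \<nu> \<in> from_nat_into B' n \<and> emeasure \<nu> I \<noteq> \<infinity>"
    using from_nat_into[OF B'(2)] by blast
  then obtain \<nu> where \<nu>: "\<And>n. \<nu> n \<in> from_nat_into B' n" "\<And>n. emeasure (\<nu> n) I \<noteq> \<infinity>"
    using choice[of "\<lambda>n \<nu>. \<nu> \<in> from_nat_into B' n \<and> emeasure \<nu> I \<noteq> \<infinity>"] by blast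
  show ?thesis
  proof (rule that[of \<nu>])
    show "\<nu> n \<in> regular_measures I" for n
    proof -
      have "from_nat_into B' n \<in> B'" by (rule from_nat_into[OF B'(2)])
      then have "from_nat_into B' n \<subseteq> regular_measures I"
        using B(2)[THEN openin_subset] by (auto simp: B'_def)
      with \<nu>(1) show ?thesis by blast
    qed
    show "\<exists>n. \<nu> n \<in> V" if V: "openin ?X V" "V \<noteq> {}" for V
    proof -
      obtain m where "m \<in> V" using V(2) by blast
      then obtain W where W: "W \<in> B" "m \<in> W" "W \<subseteq> V" using B(3) V(1) by metis
      then have "W \<in> B'" by (auto simp: B'_def)
      then obtain n where "from_nat_into B' n = W"
        using from_nat_into_surj[OF B'(1)] by blast
      then show ?thesis using \<nu>(1)[of n] W(3) by blast
    qed
  qed (rule \<nu>(2))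
qed

text \<open>Dugundji's extension formula: off \<open>A\<close>, the map is the mixture of the measures \<open>g (a i)\<close>
  with the weights above. Mixtures are formed from finite measures only; for these the masses are
  series of real numbers and depend continuously on the weights.\<close>

lemma dugundji_extension_regular_measures:
  fixes E :: "'b metric" and a :: "nat \<Rightarrow> 'b"
  assumes I: "open I" "is_interval I"
    and A: "closedin (mtopology_of E) A"
    and g: "continuous_map (subtopology (mtopology_of E) A)
      (topology_generated_by (interval_subbase I UNIV)) g"
    and a: "range a \<subseteq> A" and dense: "\<And>z e. z \<in> A \<Longrightarrow> 0 < e \<Longrightarrow> \<exists>i. mdist E z (a i) < e"
    and fin: "\<And>i. emeasure (g (a i)) I \<noteq> \<infinity>"
  obtains F where "continuous_map (mtopology_of E) (topology_generated_by (interval_subbase I UNIV)) F"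
    "\<And>x. x \<in> A \<Longrightarrow> F x = g x"
proof -
  let ?X = "topology_generated_by (interval_subbase I UNIV)"
  define M where "M = mspace E"
  define d where "d = mdist E"
  interpret Metric_space M d unfolding M_def d_def by simp
  have top: "mtopology_of E = mtopology" by (simp add: mtopology_of_def M_def d_def)
  note A = A[unfolded top] and g = g[unfolded top] and dense = dense[folded d_def]
  have AM: "A \<subseteq> M" using closedin_subset[OF A] by simp
  have gM: "g z \<in> regular_measures I" if "z \<in> A" for z
    using continuous_map_image_subset_topspace[OF g] that AM by auto
  have sets: "sets m = sets (restrict_space borel I)" "space m = I" if "m \<in> regular_measures I" for m
    using that sets_eq_imp_space_eq[of m "restrict_space borel I"]
    by (auto simp: regular_measures_def space_restrict_space)
  define \<nu> where "\<nu> i = g (a i)" for i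
  have \<nu>M: "\<nu> i \<in> regular_measures I" for i using gM a by (auto simp: \<nu>_def)
  note \<nu>_sets = sets[OF \<nu>M]
  have \<nu>_fin: "finite_measure (\<nu> i)" for i
    using fin[of i] \<nu>_sets by (intro finite_measureI) (simp add: \<nu>_def)
  have I_sets: "I \<in> sets (restrict_space borel I)" using I by (simp add: sets_restrict_borel_iff)
  \<comment> \<open>With this choice, \<open>c i * measure (\<nu> i) B \<le> (1/2)^i\<close> for every set \<open>B\<close>.\<close>
  define c where "c i = (1/2)^i / (1 + measure (\<nu> i) I)" for i
  have c: "0 < c i" "c i \<le> (1/2)^i" for i
    by (auto simp: c_def divide_le_eq add_nonneg_pos intro!: divide_pos_pos add_pos_nonneg mult_left_le)
  have h: "0 \<le> measure (\<nu> i) B \<and> c i * measure (\<nu> i) B \<le> (1/2)^i" for i B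
  proof -
    have "measure (\<nu> i) B \<le> measure (\<nu> i) I"
      using finite_measure.bounded_measure[OF \<nu>_fin, of i B] \<nu>_sets(2) by simp
    then show ?thesis
      by (auto simp: c_def divide_le_eq add_nonneg_pos add_pos_nonneg intro!: mult_left_mono)
  qed
  obtain w where w: "\<And>i x. x \<in> M - A \<Longrightarrow> 0 \<le> w i x"
    "\<And>x. x \<in> M - A \<Longrightarrow> (\<lambda>i. w i x) sums 1"
    "\<And>i x z. x \<in> M - A \<Longrightarrow> z \<in> A \<Longrightarrow> 0 < w i x \<Longrightarrow> d z (a i) < 3 * d x z"
    "\<And>h x. (\<And>i. 0 \<le> h i \<and> c i * h i \<le> (1/2)^i) \<Longrightarrow> x \<in> M - A \<Longrightarrow> summable (\<lambda>i. w i x * h i)"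
    "\<And>h. (\<And>i. 0 \<le> h i \<and> c i * h i \<le> (1/2)^i) \<Longrightarrow>
       continuous_map (subtopology mtopology (M - A)) euclideanreal (\<lambda>x. \<Sum>i. w i x * h i)"
    using dugundji_weights[OF A a dense c] by blast
  have "\<forall>x. \<exists>\<mu>. sets \<mu> = sets (restrict_space borel I) \<and> (\<forall>B\<in>sets (restrict_space borel I).
      emeasure \<mu> B = (\<Sum>i. ennreal (w i x) * emeasure (\<nu> i) B))"
    using ex_countable_mixture[of \<nu> "restrict_space borel I"] \<nu>_sets(1) by metis
  from choice[OF this] obtain mix where
    "\<forall>x. sets (mix x) = sets (restrict_space borel I) \<and> (\<forall>B\<in>sets (restrict_space borel I).
      emeasure (mix x) B = (\<Sum>i. ennreal (w i x) * emeasure (\<nu> i) B))" by blast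
  then have mix_sets: "\<And>x. sets (mix x) = sets (restrict_space borel I)"
    and mix: "\<And>x B. B \<in> sets (restrict_space borel I) \<Longrightarrow>
      emeasure (mix x) B = (\<Sum>i. ennreal (w i x) * emeasure (\<nu> i) B)"
    by auto
  define Q where "Q B x = (\<Sum>i. w i x * measure (\<nu> i) B)" for B x
  have mix_eq: "emeasure (mix x) B = ennreal (Q B x)"
    if "x \<in> M - A" "B \<in> sets (restrict_space borel I)" for x B
  proof -
    have "ennreal (w i x) * emeasure (\<nu> i) B = ennreal (w i x * measure (\<nu> i) B)" for i
      using w(1)[OF that(1)] by (simp add: finite_measure.emeasure_eq_measure[OF \<nu>_fin] ennreal_mult)
    then show ?thesis
      unfolding mix[OF that(2)] Q_def using w(1)[OF that(1)] w(4)[OF h that(1)]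
      by (simp add: suminf_ennreal2)
  qed
  have mixM: "mix x \<in> regular_measures I" if "x \<in> M - A" for x
    by (rule finite_imp_regular_measures[OF I(1) mix_sets]) (simp add: mix_eq[OF that I_sets])
  have Q_cont: "continuous_map (subtopology mtopology (M - A)) euclidean (\<lambda>x. ennreal (Q B x))" for B
  proof -
    have "continuous_map (subtopology mtopology (M - A)) euclideanreal (Q B)"
      unfolding Q_def by (rule w(5)) (rule h)
    moreover have "continuous_map euclideanreal euclidean ennreal"
      by (simp add: continuous_on_ennreal)
    ultimately have "continuous_map (subtopology mtopology (M - A)) euclidean (ennreal \<circ> Q B)"
      by (rule continuous_map_compose)
    then show ?thesis by (simp add: o_def)
  qed
  have MA: "openin mtopology (M - A)" using A by (metis closedin_def topspace_mtopology)
  have mix_open: "openin mtopology {x \<in> M - A. mix x \<in> V}" if "V \<in> interval_subbase I UNIV" for V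
    using that
  proof (cases rule: interval_subbaseE)
    case 1
    then have "{x \<in> M - A. mix x \<in> V} = M - A" using mixM by auto
    then show ?thesis using MA by simp
  next
    case (2 s b t)
    note B = rational_interval_sets(1)[OF I, of s b]
    have "{x \<in> M - A. mix x \<in> V} = {x \<in> M - A. ennreal (Q {s<..<b} x) \<in> {t<..}}"
      unfolding 2 lower_set_def using mixM mix_eq[OF _ B] 2 by auto
    moreover have "openin (subtopology mtopology (M - A)) {x \<in> M - A. ennreal (Q {s<..<b} x) \<in> {t<..}}"
      using openin_continuous_map_preimage[OF Q_cont, of "{t<..}" "{s<..<b}"] by (simp add: Int_absorb1)
    ultimately show ?thesis using MA by (simp add: openin_open_subtopology)
  next
    case (3 s b t)
    note B = rational_interval_sets(2)[OF I, of s b]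
    have "{x \<in> M - A. mix x \<in> V} = {x \<in> M - A. ennreal (Q {s..b} x) \<in> {..<t}}"
      unfolding 3 upper_set_def using mixM mix_eq[OF _ B] 3 by auto
    moreover have "openin (subtopology mtopology (M - A)) {x \<in> M - A. ennreal (Q {s..b} x) \<in> {..<t}}"
      using openin_continuous_map_preimage[OF Q_cont, of "{..<t}" "{s..b}"] by (simp add: Int_absorb1)
    ultimately show ?thesis using MA by (simp add: openin_open_subtopology)
  qed
  \<comment> \<open>Subbasic sets are closed under countable convex combinations.\<close>
  have mix_convex: "mix y \<in> V"
    if V: "V \<in> interval_subbase I UNIV" and y: "y \<in> M - A" and mem: "\<And>i. 0 < w i y \<Longrightarrow> \<nu> i \<in> V" for V y
    using V
  proof (cases rule: interval_subbaseE)
    case 1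
    then show ?thesis using mixM y by simp
  next
    case (2 s b t)
    let ?B = "{s<..<b}"
    have B: "?B \<in> sets (restrict_space borel I)"
      using 2 by (intro rational_interval_sets[OF I]) auto
    have less: "t < ennreal (measure (\<nu> i) ?B)" if "0 < w i y" for i
      using mem[OF that] 2 by (simp add: lower_set_def finite_measure.emeasure_eq_measure[OF \<nu>_fin])
    have "t < ennreal (Q ?B y)"
    proof (cases t)
      case (real r)
      have "r < Q ?B y"
        unfolding Q_def
        by (rule convex_series_less[OF w(1)[OF y] w(2)[OF y] w(4)[OF h y]])
          (use less real in \<open>auto simp: ennreal_less_iff\<close>)
      then show ?thesis using real by (simp add: ennreal_less_iff)
    next
      case top
      \<comment> \<open>No mass exceeds an infinite level, so no weight is positive, although they sum to 1.\<close>
      have "Q ?B y < Q ?B y"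
        unfolding Q_def
        by (rule convex_series_less[OF w(1)[OF y] w(2)[OF y] w(4)[OF h y]])
          (use less top in auto)
      then show ?thesis by simp
    qed
    then show ?thesis
      using mixM[OF y] mix_eq[OF y B] 2 by (simp add: lower_set_def)
  next
    case (3 s b t)
    let ?B = "{s..b}"
    have B: "?B \<in> sets (restrict_space borel I)"
      using 3 by (intro rational_interval_sets[OF I]) auto
    have less: "ennreal (measure (\<nu> i) ?B) < t" if "0 < w i y" for i
      using mem[OF that] 3 by (simp add: upper_set_def finite_measure.emeasure_eq_measure[OF \<nu>_fin])
    have "ennreal (Q ?B y) < t"
    proof (cases t)
      case (real r)
      have sm: "summable (\<lambda>i. w i y * measure (\<nu> i) ?B)" by (rule w(4)[OF h y])
      have "- r < (\<Sum>i. w i y * - measure (\<nu> i) ?B)"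
        by (rule convex_series_less[OF w(1)[OF y] w(2)[OF y]])
          (use less real sm in \<open>auto simp: ennreal_less_iff summable_minus\<close>)
      also have "\<dots> = - Q ?B y"
        unfolding Q_def using sm by (simp add: suminf_minus)
      finally have "Q ?B y < r" by simp
      moreover have "0 \<le> Q ?B y"
        unfolding Q_def using w(1)[OF y] by (intro suminf_nonneg sm) simp
      ultimately show ?thesis using real by (simp add: ennreal_less_iff)
    qed simp
    then show ?thesis
      using mixM[OF y] mix_eq[OF y B] 3 by (simp add: upper_set_def)
  qed
  define F where "F x = (if x \<in> A then g x else mix x)" for x
  have "continuous_map mtopology ?X F"
  proof (rule continuous_on_generated_topo)
    show "F ` topspace mtopology \<subseteq> \<Union> (interval_subbase I UNIV)"
      using gM mixM by (auto simp: F_def)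
    fix V assume V: "V \<in> interval_subbase I UNIV"
    show "openin mtopology (F -` V \<inter> topspace mtopology)"
    proof (subst openin_subopen, intro ballI)
      fix x assume x: "x \<in> F -` V \<inter> topspace mtopology"
      show "\<exists>T. openin mtopology T \<and> x \<in> T \<and> T \<subseteq> F -` V \<inter> topspace mtopology"
      proof (cases "x \<in> A")
        case False
        with x show ?thesis
          by (intro exI[of _ "{x \<in> M - A. mix x \<in> V}"] conjI mix_open V) (auto simp: F_def)
      next
        case True
        have "openin (subtopology mtopology A) {z \<in> topspace (subtopology mtopology A). g z \<in> V}"
          using V by (intro openin_continuous_map_preimage[OF g] topology_generated_by_Basis)
        then obtain T where T: "openin mtopology T" "{z \<in> topspace (subtopology mtopology A). g z \<in> V} = T \<inter> A"
          by (auto simp: openin_subtopology)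
        have "x \<in> T" using T(2) True x AM by (auto simp: F_def)
        then obtain r where r: "0 < r" "mball x r \<subseteq> T"
          using T(1) unfolding openin_mtopology by blast
        have g_near: "g z \<in> V" if "z \<in> A" "d x z < r" for z
        proof -
          have "z \<in> mball x r" using that AM True by auto
          with r(2) that(1) T(2) show ?thesis by blast
        qed
        show ?thesis
        proof (intro exI[of _ "mball x (r/3)"] conjI subsetI)
          show "openin mtopology (mball x (r/3))" "x \<in> mball x (r/3)"
            using r(1) True AM by auto
          fix y assume y: "y \<in> mball x (r/3)"
          then have yM: "y \<in> M" and dxy: "3 * d x y < r" by auto
          have "F y \<in> V"
          proof (cases "y \<in> A")
            case True
            then show ?thesis using g_near[of y] dxy nonneg[of x y] by (simp add: F_def)
          next
            case False
            \<comment> \<open>Points \<open>a i\<close> of positive weight at \<open>y\<close> have distance less than \<open>3 * d x y < r\<close> from \<open>x\<close>.\<close>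
            have "\<nu> i \<in> V" if "0 < w i y" for i
              unfolding \<nu>_def using w(3)[of y x i] False yM True that dxy commute[of x y] a
              by (intro g_near) auto
            then show ?thesis
              using mix_convex[OF V, of y] False yM by (simp add: F_def)
          qed
          then show "y \<in> F -` V \<inter> topspace mtopology" using yM by simp
        qed
      qed
    qed
  qed
  then show ?thesis using that[of F] by (simp add: top F_def)
qed

theorem theorem2p9:
  fixes \<alpha> \<beta> :: ereal and I :: "real set" and \<theta> :: "real measure topology"
  assumes "\<alpha> < \<beta>"
    and "I = einterval \<alpha> \<beta>"
    and "coarsest_topology_on (regular_measures I) (interval_semicontinuous I) \<theta>"
  shows "compact_absolute_retract TYPE('b) \<theta>"
proof -
  have "open I" by (simp add: assms(2))
  moreover have "is_interval I"
    unfolding assms(2) is_interval_1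
  proof (intro ballI allI impI, elim conjE)
    fix a b x assume "a \<in> einterval \<alpha> \<beta>" "b \<in> einterval \<alpha> \<beta>" "a \<le> x" "x \<le> b"
    then show "x \<in> einterval \<alpha> \<beta>"
      using order_less_le_trans[of \<alpha> "ereal a" "ereal x"] order_le_less_trans[of "ereal x" "ereal b" \<beta>]
      by (simp add: einterval_iff)
  qed
  ultimately have I: "open I" "is_interval I" .
  obtain D :: "ennreal set" where "countable D" and D: "\<And>U. open U \<Longrightarrow> U \<noteq> {} \<Longrightarrow> \<exists>d\<in>D. d \<in> U"
    using countable_dense_exists[where 'a=ennreal] by auto
  have \<theta>: "\<theta> = topology_generated_by (interval_subbase I UNIV)"
    using assms(3) coarsest_topology_on_interval_subbase[of UNIV I] dense
    by (intro coarsest_topology_on_unique) auto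
  have "\<theta> = topology_generated_by (interval_subbase I D)"
  proof (rule coarsest_topology_on_unique[OF assms(3)], rule coarsest_topology_on_interval_subbase)
    show "\<exists>d\<in>D. x < d \<and> d < y" if "x < y" for x y
      using D[of "{x<..<y}"] dense[OF that] by auto
  qed
  then have second_countable: "second_countable \<theta>"
    using second_countable_topology_generated_by countable_interval_subbase \<open>countable D\<close> by metis
  have compact: "compact_space \<theta>"
    unfolding \<theta> by (rule compact_space_interval_subbase[OF I])
  have metrizable: "metrizable_space \<theta>"
    using compact Hausdorff_space_interval_subbase[OF I(1)] second_countable
    unfolding \<theta> by (intro compact_Hausdorff_second_countable_imp_metrizable)
  have topspace: "topspace \<theta> = regular_measures I"
    by (simp add: \<theta>)
  obtain \<nu> :: "nat \<Rightarrow> real measure" where \<nu>: "\<And>n. \<nu> n \<in> regular_measures I" "\<And>n. emeasure (\<nu> n) I \<noteq> \<infinity>"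
    "\<And>V. openin \<theta> V \<Longrightarrow> V \<noteq> {} \<Longrightarrow> \<exists>n. \<nu> n \<in> V"
    using dense_sequence_of_finite_measures[OF I second_countable[unfolded \<theta>]] unfolding \<theta> by blast
  have "absolute_retract TYPE('b) E" if E: "mtopology_of E = \<theta>" for E
    unfolding absolute_retract_def E
  proof (intro allI impI, elim conjE)
    fix E' :: "'b metric" and f
    assume f: "embedding_map \<theta> (mtopology_of E') f" and closed: "closedin (mtopology_of E') (f ` mspace E)"
    have M: "mspace E = regular_measures I"
      using topspace E by (metis topspace_mtopology_of)
    define A where "A = f ` mspace E"
    have "homeomorphic_map \<theta> (subtopology (mtopology_of E') A) f"
      using f unfolding embedding_map_def A_def M topspace .
    then obtain g where "homeomorphic_maps \<theta> (subtopology (mtopology_of E') A) f g"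
      by (auto simp: homeomorphic_map_maps)
    then have f_cont: "continuous_map \<theta> (subtopology (mtopology_of E') A) f"
      and g_cont: "continuous_map (subtopology (mtopology_of E') A) \<theta> g"
      and gf: "\<And>m. m \<in> regular_measures I \<Longrightarrow> g (f m) = m"
      unfolding homeomorphic_maps_def topspace by auto
    \<comment> \<open>The pullback of a ball around \<open>z\<close> is nonempty and open, hence contains some \<open>\<nu> i\<close>.\<close>
    have dense_image: "\<exists>i. mdist E' z (f (\<nu> i)) < e" if z: "z \<in> A" and "0 < e" for z e
    proof -
      obtain m where m: "m \<in> regular_measures I" "z = f m" using z by (auto simp: A_def M)
      interpret Metric_space "mspace E'" "mdist E'" by simp
      have "z \<in> mspace E'" using z closedin_subset[OF closed] by (auto simp: A_def)
      have "continuous_map \<theta> (mtopology_of E') f"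
        using f_cont by (simp add: continuous_map_in_subtopology)
      then have "openin \<theta> {n \<in> topspace \<theta>. f n \<in> mball z e}"
        by (rule openin_continuous_map_preimage) (simp add: mtopology_of_def)
      moreover have "m \<in> {n \<in> topspace \<theta>. f n \<in> mball z e}"
        using m \<open>z \<in> mspace E'\<close> \<open>0 < e\<close> by (simp add: topspace)
      ultimately obtain i where "\<nu> i \<in> {n \<in> topspace \<theta>. f n \<in> mball z e}"
        using \<nu>(3) by blast
      then show ?thesis by auto
    qed
    have fin: "emeasure (g (f (\<nu> i))) I \<noteq> \<infinity>" for i
      using \<nu>(2)[of i] gf[OF \<nu>(1)[of i]] by simp
    have range: "range (\<lambda>i. f (\<nu> i)) \<subseteq> A" using \<nu>(1) by (auto simp: A_def M)
    obtain F where F: "continuous_map (mtopology_of E') \<theta> F" "\<And>x. x \<in> A \<Longrightarrow> F x = g x"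
      using dugundji_extension_regular_measures[OF I closed[folded A_def] g_cont[unfolded \<theta>] range dense_image fin]
      unfolding \<theta> by blast
    show "(f ` mspace E) retract_of_space (mtopology_of E')"
      unfolding retract_of_space_def
    proof (intro conjI exI ballI)
      show "f ` mspace E \<subseteq> topspace (mtopology_of E')"
        by (rule closedin_subset[OF closed])
      show "continuous_map (mtopology_of E') (subtopology (mtopology_of E') (f ` mspace E)) (f \<circ> F)"
        using continuous_map_compose[OF F(1) f_cont] by (simp add: A_def)
      show "(f \<circ> F) x = x" if "x \<in> f ` mspace E" for x
        using that F(2)[of x] gf by (auto simp: A_def M)
    qed
  qed
  with metrizable compact show ?thesis
    by (simp add: compact_absolute_retract_def)
qed

end
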